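(* Let $\mathbf{k}$ be an index of positive integers. Then there exist numbers $c_{\mathbf{k}}(\mathbf{k}';j)$, indexed by pairs $(\mathbf{k}',j)$ with $\mathbf{k}'$ an index of positive integers (possibly empty) and $j\ge0$ an integer with $|\mathbf{k}'|+j\le|\mathbf{k}|$, each $c_{\mathbf{k}}(\mathbf{k}';j)$ a $\mathbb{Q}$-linear combination of multiple zeta values of weight $|\mathbf{k}|-|\mathbf{k}'|-j$, such that, as meromorphic functions of $s\in\mathbb{C}$, \[\xi(\mathbf{k};s)=\sum_{\mathbf{k}',\,j\ge0}c_{\mathbf{k}}(\mathbf{k}';j)\binom{s+j-1}{j}\zeta(\mathbf{k}';s+j).\]
   Context: $\mathrm{Li}_{k_1,\ldots,k_r}(z)=\sum_{1\le m_1<\cdots<m_r} z^{m_r}/(m_1^{k_1}\cdots m_r^{k_r})$, analytically continued to $\mathbb{C}\setminus[1,\infty)$. For $\mathbf{k}$ of depth $r$ and $\mathrm{Re}(s)>1-r$, $\xi(\mathbf{k};s)=\frac{1}{\Gamma(s)}\int_0^\infty t^{s-1}\frac{\mathrm{Li}_{\mathbf{k}}(1-e^{-t})}{e^t-1}dt$, which extends to an entire function. For positive integers $l_1,\ldots,l_r$, the multiple zeta function $\zeta(l_1,\ldots,l_r;s)=\sum_{1\le m_1<\cdots<m_r<m}\frac{1}{m_1^{l_1}\cdots m_r^{l_r}m^s}$, meromorphically continued to $\mathbb{C}$; $\zeta(\emptyset;s)=\zeta(s)$ is the Riemann zeta function. $|\mathbf{k}|$ denotes the weight (sum of entries), $|\emptyset|=0$.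 Multiple zeta values are $\zeta(l_1,\ldots,l_r)=\sum_{1\le m_1<\cdots<m_r}m_1^{-l_1}\cdots m_r^{-l_r}$ ($l_r\ge2$) of weight $l_1+\cdots+l_r$; $1$ counts as a multiple zeta value of weight $0$. $\binom{s+j-1}{j}=s(s+1)\cdots(s+j-1)/j!$. *)

theory Defs
  imports "HOL-Complex_Analysis.Complex_Analysis"
begin

text \<open>
  An index \<open>(k\<^sub>1, \<dots>, k\<^sub>r)\<close> is the list \<open>[k\<^sub>1, \<dots>, k\<^sub>r]\<close>; its depth is \<^const>\<open>length\<close>, its
  weight is \<^const>\<open>sum_list\<close>, and the empty index is \<open>[]\<close>.
\<close>

definition is_index :: "nat list \<Rightarrow> bool" where
  "is_index ks \<longleftrightarrow> (\<forall>k\<in>set ks. k \<ge> 1)"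

text \<open>The summation range \<open>1 \<le> m\<^sub>1 < \<dots> < m\<^sub>r\<close>; for \<open>r = 0\<close> it consists of the empty tuple only.\<close>

definition incr_tuples :: "nat \<Rightarrow> nat list set" where
  "incr_tuples r = {ms. length ms = r \<and> sorted_wrt (<) ms \<and> (\<forall>m\<in>set ms. m \<ge> 1)}"

text \<open>
  The multiple polylogarithm as its power series, which converges for \<open>\<bar>z\<bar> < 1\<close>. The continuation
  to the plane slit along \<open>[1,\<infinity>)\<close> is not needed: below, the argument is \<open>1 - exp (-t)\<close> with
  \<open>t > 0\<close>, a point of \<open>(0,1)\<close>. Intended for non-empty \<open>ks\<close> only.
\<close>

definition Li :: "nat list \<Rightarrow> complex \<Rightarrow> complex" where
  "Li ks z = (\<Sum>\<^sub>\<infinity>ms\<in>incr_tuples (length ks).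
     z ^ last ms / (\<Prod>i<length ks. of_nat (ms ! i) ^ (ks ! i)))"

text \<open>
  The integral representation, on \<open>Re s > 1 - r\<close>; \<^const>\<open>rGamma\<close> is the entire function \<open>1 / \<Gamma>\<close>.
\<close>

definition xi_integral :: "nat list \<Rightarrow> complex \<Rightarrow> complex" where
  "xi_integral ks s = rGamma s *
     (LINT t:{0<..}|lborel.
        of_real t powr (s - 1) * Li ks (1 - exp (- of_real t)) / (exp (of_real t) - 1))"

text \<open>The entire continuation, unique by the identity theorem. Intended for non-empty \<open>ks\<close>.\<close>

definition xi :: "nat list \<Rightarrow> complex \<Rightarrow> complex" where
  "xi ks = (THE f. f holomorphic_on UNIV \<and>
     (\<forall>s. Re s > 1 - real (length ks) \<longrightarrow> f s = xi_integral ks s))"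

text \<open>
  The series \<open>\<zeta>(l\<^sub>1, \<dots>, l\<^sub>r; s)\<close>, summed over \<open>m\<^sub>1 < \<dots> < m\<^sub>r < m\<close> with \<open>m\<close> the last entry of the
  tuple. It converges (absolutely) exactly for \<open>Re s > 1\<close>; for \<open>ls = []\<close> it is the series of the
  Riemann zeta function.
\<close>

definition mzeta_series :: "nat list \<Rightarrow> complex \<Rightarrow> complex" where
  "mzeta_series ls s = (\<Sum>\<^sub>\<infinity>ms\<in>incr_tuples (Suc (length ls)).
     1 / ((\<Prod>i<length ls. of_nat (ms ! i) ^ (ls ! i)) * of_nat (ms ! length ls) powr s))"

text \<open>
  The meromorphic continuation. Requiring it to be nicely meromorphic only normalises the total
  function representing it (value 0 at poles, no removable singularities), which makes it unique.
\<close>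

definition mzeta :: "nat list \<Rightarrow> complex \<Rightarrow> complex" where
  "mzeta ls = (THE f. f nicely_meromorphic_on UNIV \<and>
     (\<forall>s. Re s > 1 \<longrightarrow> f s = mzeta_series ls s))"

definition mzv :: "nat list \<Rightarrow> real" where
  "mzv ls = (\<Sum>\<^sub>\<infinity>ms\<in>incr_tuples (length ls).
     1 / (\<Prod>i<length ls. of_nat (ms ! i) ^ (ls ! i)))"

text \<open>
  The empty index is admissible and gives the multiple zeta value 1 of weight 0. There are no
  multiple zeta values of weight 1.
\<close>

definition mzvs_of_weight :: "nat \<Rightarrow> real set" where
  "mzvs_of_weight w =
     {mzv ls | ls. is_index ls \<and> (ls \<noteq> [] \<longrightarrow> last ls \<ge> 2) \<and> sum_list ls = w}"

definition rat_span :: "real set \<Rightarrow> real set" where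
  "rat_span = module.span (\<lambda>(q::rat) (x::real). of_rat q * x)"

lemma module_rat_real: "module (\<lambda>(q::rat) (x::real). of_rat q * x)"
  by unfold_locales (simp_all add: algebra_simps of_rat_add of_rat_mult)

lemma mzv_Nil: "mzv [] = 1"
proof -
  have "incr_tuples 0 = {[]}"
    by (auto simp: incr_tuples_def)
  then show ?thesis
    by (simp add: mzv_def)
qed

definition index_pairs :: "nat \<Rightarrow> (nat list \<times> nat) set" where
  "index_pairs w = {(ls, j). is_index ls \<and> sum_list ls + j \<le> w}"

lemma finite_index_pairs: "finite (index_pairs w)"
proof -
  have len: "length ls \<le> sum_list ls" if "is_index ls" for ls
    using that unfolding is_index_def by (induction ls) auto
  have "index_pairs w \<subseteq> {ls. set ls \<subseteq> {..w} \<and> length ls \<le> w} \<times> {..w}"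
    using len member_le_sum_list unfolding index_pairs_def by fastforce
  then show ?thesis
    by (rule finite_subset) (intro finite_cartesian_product finite_lists_length_le; simp)
qed

end

theory Submission
  imports Defs
begin

text \<open>
  By induction on the weight, \<open>Li\<^sub>k(1 - z)\<close> is a combination of the products
  \<open>(- log z)\<^sup>j / j! * Li\<^sub>l(z)\<close>: differentiate, apply the induction hypothesis, integrate by parts, and
  find the constant of integration at an endpoint, where it is a multiple zeta value or a
  combination of products of two of them. Putting \<open>z = exp (- t)\<close> and taking Mellin transforms term by term gives the
  formula for \<open>Re s > 1\<close>, since the transform of \<open>t\<^sup>j Li\<^sub>l(exp (- t)) / (exp t - 1)\<close> is
  \<open>\<Gamma>(s + j) \<zeta>(l; s + j)\<close>. Both sides are meromorphic on the plane: \<open>\<zeta>(l; s)\<close> is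
  continued by the translation equation expressing \<open>\<zeta>(l'; s - 1 + l\<^sub>r)\<close>, with \<open>l'\<close> the index \<open>l\<close> without
  its last entry \<open>l\<^sub>r\<close>, through the values \<open>\<zeta>(l; s + i)\<close> with \<open>i \<ge> 0\<close>, and \<open>\<xi>(k; s)\<close> by expanding \<open>Li\<^sub>k(1 - exp (- t))\<close> in powers of \<open>1 - exp (- t)\<close>.
\<close>

subsection \<open>Truncated multiple harmonic sums\<close>

text \<open>All series are reduced to sums over the outermost variable n with coefficients
  \<open>hsum\<close>, which grow slower than any positive power of n; this bound governs every
  convergence question. The connection formula is shaped by divergence at the endpoints. A primitive
  for the kernel 1/(1 - z) may contain polylogarithms with leading exponent 1, which diverge at z =
  1, so the constant is read off at z = 0. A primitive for 1/z may be a bare power of the logarithm,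
  which diverges at z = 0, so the constant is read off at z = 1. There old coefficients are
  multiplied by new zeta values, hence the need for a product on the spans that adds weights. The
  weights of coefficient, logarithm and polylogarithm always add up to the same total, which is what
  fixes the weights in the result. The formula is used a second time: it bounds the polylogarithm at
  1 - exp(-t) for large t, which the entire continuation of \<open>xi\<close> requires.\<close>

text \<open>
  Indices of \<open>hsum\<close>, and of all functions below built on it, are in reverse order: the head of the
  list belongs to the largest summation variable.
\<close>

primrec hsum :: "nat list \<Rightarrow> nat \<Rightarrow> real" where
  "hsum [] n = 1"
| "hsum (k # ks) n = (\<Sum>m=1..<n. hsum ks m / real m ^ k)"

lemma hsum_Cons_Suc: "n \<ge> 1 \<Longrightarrow> hsum (k # ks) (Suc n) = hsum (k # ks) n + hsum ks n / real n ^ k"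
  by (simp add: atLeastLessThanSuc)

declare hsum.simps(2) [simp del]

lemma hsum_Cons_0 [simp]: "hsum (k # ks) 0 = 0" "hsum (k # ks) (Suc 0) = 0"
  by (simp_all add: hsum.simps(2))

lemma hsum_nonneg: "hsum ks n \<ge> 0"
proof (induction ks arbitrary: n)
  case (Cons k ks)
  then show ?case
    by (auto simp: hsum.simps(2) intro!: sum_nonneg)
qed simp

text \<open>There are too few positive integers below \<open>n\<close> for a strictly monotone chain
  of this length. These zeros are the source of the half-plane Re s > 1 - r for the integral
  defining \<open>xi\<close>.\<close>

lemma hsum_eq_0: "n \<le> length ks \<Longrightarrow> ks \<noteq> [] \<Longrightarrow> hsum ks n = 0"
proof (induction ks arbitrary: n)
  case (Cons k ks)
  show ?case
  proof (cases "ks = []")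
    case True
    then show ?thesis
      using Cons.prems by (simp add: hsum.simps(2))
  next
    case False
    then show ?thesis
      using Cons by (auto simp: hsum.simps(2) intro!: sum.neutral)
  qed
qed simp

text \<open>All exponents are at least 1, so each variable contributes at most a harmonic sum once
  the ordering of the variables is dropped.\<close>

lemma hsum_le_harm:
  assumes "is_index ks"
  shows "hsum ks n \<le> harm n ^ length ks"
  using assms
proof (induction ks arbitrary: n)
  case (Cons k ks)
  have "hsum (k # ks) n \<le> (\<Sum>m=1..<n. harm n ^ length ks * inverse (real m))"
    unfolding hsum.simps(2)
  proof (rule sum_mono)
    fix m assume m: "m \<in> {1..<n}"
    have "hsum ks m \<le> harm n ^ length ks"
      using m Cons by (force simp: is_index_def intro: order_trans[OF _ power_mono] harm_mono harm_nonneg)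
    moreover have "inverse (real m ^ k) \<le> inverse (real m)"
      using m Cons.prems by (intro le_imp_inverse_le self_le_power) (auto simp: is_index_def)
    ultimately show "hsum ks m / real m ^ k \<le> harm n ^ length ks * inverse (real m)"
      unfolding divide_inverse by (intro mult_mono) (auto simp: harm_nonneg)
  qed
  also have "\<dots> \<le> harm n ^ length ks * harm n"
    unfolding harm_def sum_distrib_left[symmetric]
    by (intro mult_left_mono sum_mono2) (auto intro!: sum_nonneg zero_le_power)
  finally show ?case
    by (simp add: mult.commute)
qed simp

text \<open>\<open>harm n\<close> is at most 1 + ln n, hence at most (1 + 1/d) n^d for every d > 0.
  Arbitrarily slow growth gives absolute convergence for Re s > 1 whatever the index.\<close>

lemma hsum_bound:
  assumes "is_index ks" "0 < e"
  obtains C where "C \<ge> 0" "\<And>n. n \<ge> 1 \<Longrightarrow> hsum ks n \<le> C * real n powr e"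
proof -
  \<comment> \<open>The denominator exceeds the depth by one: the product of depth many factors
    \<open>n powr d\<close> stays below \<open>n powr e\<close>, and the empty index causes no
    division by zero.\<close>
  define d where "d = e / (real (length ks) + 1)"
  have d: "d > 0"
    using assms by (simp add: d_def)
  have de: "d * real (length ks) \<le> e"
    using assms by (simp add: d_def field_simps)
  have "hsum ks n \<le> (1 + 1 / d) ^ length ks * real n powr e" if n: "n \<ge> 1" for n
  proof -
    have "harm n \<le> ln (real n) + 1"
    proof -
      have "harm 1 = (1 :: real)"
        by (simp add: harm_def)
      then show ?thesis
        using n euler_mascheroni_sequence_decreasing[of 1 n] by simp
    qed
    also have "\<dots> \<le> real n powr d / d + real n powr d"
      using n d by (intro add_mono ln_powr_bound ge_one_powr_ge_zero) auto
    finally have h: "harm n \<le> (1 + 1 / d) * real n powr d"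
      by (simp add: algebra_simps)
    have "hsum ks n \<le> harm n ^ length ks"
      by (rule hsum_le_harm) fact
    also have "\<dots> \<le> ((1 + 1 / d) * real n powr d) ^ length ks"
      by (rule power_mono[OF h harm_nonneg])
    also have "\<dots> = (1 + 1 / d) ^ length ks * real n powr (d * real (length ks))"
      using n by (simp add: power_mult_distrib powr_powr[symmetric] powr_realpow)
    also have "\<dots> \<le> (1 + 1 / d) ^ length ks * real n powr e"
      using n d de by (intro mult_left_mono powr_mono) auto
    finally show ?thesis .
  qed
  then show ?thesis
    using d by (intro that[of "(1 + 1 / d) ^ length ks"]) auto
qed

lemma summable_hsum_powr:
  assumes "is_index ks" "a > 1"
  shows "summable (\<lambda>n. hsum ks (Suc n) * real (Suc n) powr (-a))"
proof -
  \<comment> \<open>Half of the excess \<open>a - 1\<close> is spent on the coefficients; the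
    exponent left is -(a + 1)/2, still below -1.\<close>
  obtain C where C: "C \<ge> 0" "\<And>n. n \<ge> 1 \<Longrightarrow> hsum ks n \<le> C * real n powr ((a - 1) / 2)"
    using hsum_bound[of ks "(a - 1) / 2"] assms by auto
  have "summable (\<lambda>n. real n powr (-((a + 1) / 2)))"
    using assms by (subst summable_real_powr_iff) auto
  then have "summable (\<lambda>n. real (Suc n) powr (-((a + 1) / 2)))"
    by (subst summable_Suc_iff)
  then have "summable (\<lambda>n. C * real (Suc n) powr (-((a + 1) / 2)))"
    by (rule summable_mult)
  then show ?thesis
  proof (rule summable_comparison_test'[where N = 0])
    fix n
    have "hsum ks (Suc n) * real (Suc n) powr (-a) \<le> C * real (Suc n) powr ((a - 1) / 2) * real (Suc n) powr (-a)"
      by (intro mult_right_mono C) auto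
    also have "\<dots> = C * real (Suc n) powr (-((a + 1) / 2))"
    proof -
      have "(a - 1) / 2 + - a = - ((a + 1) / 2)"
        by (simp add: field_simps)
      then show ?thesis
        by (simp only: mult.assoc powr_add[symmetric])
    qed
    finally show "norm (hsum ks (Suc n) * real (Suc n) powr (-a)) \<le> C * real (Suc n) powr (-((a + 1) / 2))"
      by (simp add: hsum_nonneg)
  qed
qed

lemma summable_hsum_power:
  assumes "is_index ks" "k \<ge> 2"
  shows "summable (\<lambda>n. hsum ks (Suc n) / real (Suc n) ^ k)"
  using summable_hsum_powr[OF assms(1), of "real k"] assms(2)
  by (simp add: powr_minus powr_realpow field_simps del: of_nat_Suc)

subsection \<open>Sums over increasing tuples\<close>

abbreviation tuple_weight :: "nat list \<Rightarrow> nat list \<Rightarrow> nat" where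
  "tuple_weight ls ms \<equiv> (\<Prod>i<length ls. ms ! i ^ (ls ! i))"

text \<open>The choices of the inner variables once the outermost one is fixed to be
  \<open>n\<close>. These sets are finite, so only the outermost sum raises a question of
  convergence.\<close>

definition tuples_below :: "nat \<Rightarrow> nat \<Rightarrow> nat list set" where
  "tuples_below r n = {ms \<in> incr_tuples r. \<forall>m\<in>set ms. m < n}"

lemma incr_tuples_0: "incr_tuples 0 = {[]}"
  by (auto simp: incr_tuples_def)

lemma snoc_in_incr_tuples:
  "ms @ [m] \<in> incr_tuples (Suc r) \<longleftrightarrow> m \<ge> 1 \<and> ms \<in> tuples_below r m"
  by (auto simp: incr_tuples_def tuples_below_def sorted_wrt_append)

lemma tuples_below_0: "tuples_below 0 n = {[]}"
  by (auto simp: tuples_below_def incr_tuples_0)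

lemma bij_betw_snoc_incr_tuples:
  "bij_betw (\<lambda>(m, ms). ms @ [m]) (SIGMA m:{1..}. tuples_below r m) (incr_tuples (Suc r))"
proof (rule bij_betw_byWitness[where f' = "\<lambda>ms. (last ms, butlast ms)"])
  show "\<forall>ms\<in>incr_tuples (Suc r). (case (last ms, butlast ms) of (m, ms) \<Rightarrow> ms @ [m]) = ms"
    by (auto simp: incr_tuples_def intro!: append_butlast_last_id)
  have "(last ms, butlast ms) \<in> (SIGMA m:{1..}. tuples_below r m)" if "ms \<in> incr_tuples (Suc r)" for ms
    using that snoc_in_incr_tuples[of "butlast ms" "last ms" r]
    by (subst (asm) append_butlast_last_id) (auto simp: incr_tuples_def)
  then show "(\<lambda>ms. (last ms, butlast ms)) ` incr_tuples (Suc r) \<subseteq> (SIGMA m:{1..}. tuples_below r m)"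
    by blast
qed (auto simp: snoc_in_incr_tuples)

lemma bij_betw_snoc_tuples_below:
  "bij_betw (\<lambda>(m, ms). ms @ [m]) (SIGMA m:{1..<n}. tuples_below r m) (tuples_below (Suc r) n)"
proof -
  have "bij_betw (\<lambda>(m, ms). ms @ [m]) (SIGMA m:{1..<n}. tuples_below r m)
          ((\<lambda>(m, ms). ms @ [m]) ` (SIGMA m:{1..<n}. tuples_below r m))"
    by (rule bij_betw_subset[OF bij_betw_snoc_incr_tuples]) auto
  also have "(\<lambda>(m, ms). ms @ [m]) ` (SIGMA m:{1..<n}. tuples_below r m) = tuples_below (Suc r) n"
    (is "?A = ?B")
  proof (intro equalityI subsetI)
    fix ms assume ms: "ms \<in> ?B"
    then have "ms = butlast ms @ [last ms]"
      by (auto simp: tuples_below_def incr_tuples_def intro!: append_butlast_last_id[symmetric])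
    moreover from this have "last ms \<ge> 1 \<and> butlast ms \<in> tuples_below r (last ms)"
      using ms snoc_in_incr_tuples[of "butlast ms" "last ms" r] by (auto simp: tuples_below_def)
    moreover have "last ms < n"
      using ms last_in_set[of ms] by (cases "ms = []") (auto simp: tuples_below_def incr_tuples_def)
    ultimately show "ms \<in> ?A"
      by (auto intro!: rev_image_eqI[of "(last ms, butlast ms)"])
  qed (auto simp: tuples_below_def incr_tuples_def sorted_wrt_append; metis order.strict_trans)
  finally show ?thesis .
qed

lemma finite_tuples_below: "finite (tuples_below r n)"
proof (induction r arbitrary: n)
  case (Suc r)
  then show ?case
    using bij_betw_finite[OF bij_betw_snoc_tuples_below[of n r]] by auto
qed (simp add: tuples_below_0)

lemma tuple_weight_snoc:
  assumes "ms \<in> tuples_below (length ls) m"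
  shows "tuple_weight (ls @ [l]) (ms @ [m]) = tuple_weight ls ms * m ^ l"
  using assms by (auto simp: tuples_below_def incr_tuples_def nth_append intro!: prod.cong)

lemma sum_tuples_below: "(\<Sum>ms\<in>tuples_below (length ls) n. 1 / real (tuple_weight ls ms)) = hsum (rev ls) n"
proof (induction ls arbitrary: n rule: rev_induct)
  case (snoc l ls)
  have "(\<Sum>ms\<in>tuples_below (length (ls @ [l])) n. 1 / real (tuple_weight (ls @ [l]) ms)) =
    (\<Sum>(m, ms)\<in>(SIGMA m:{1..<n}. tuples_below (length ls) m). 1 / real (tuple_weight (ls @ [l]) (ms @ [m])))"
    using sum.reindex_bij_betw[OF bij_betw_snoc_tuples_below, symmetric,
      of "\<lambda>ms. 1 / real (tuple_weight (ls @ [l]) ms)" "length ls" n]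
    by (simp add: case_prod_unfold)
  also have "\<dots> = (\<Sum>m=1..<n. \<Sum>ms\<in>tuples_below (length ls) m. 1 / real (tuple_weight (ls @ [l]) (ms @ [m])))"
    by (subst sum.Sigma) (auto simp: finite_tuples_below)
  also have "\<dots> = (\<Sum>m=1..<n. \<Sum>ms\<in>tuples_below (length ls) m. 1 / real (tuple_weight ls ms) / real m ^ l)"
    by (intro sum.cong refl, subst tuple_weight_snoc) auto
  also have "\<dots> = hsum (rev (ls @ [l])) n"
    by (simp only: sum_divide_distrib[symmetric] snoc.IH hsum.simps(2) rev_append) (simp add: hsum.simps(2))
  finally show ?case .
qed (simp add: tuples_below_0)

lemma range_Suc: "range Suc = {1..}"
  by (auto simp: image_iff Suc_le_eq gr0_conv_Suc)

text \<open>Fubini with the last entry outermost: the inner sums are finite and equal to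
  \<open>hsum\<close>, and the same computation with norms turns the hypothesis into absolute
  summability over all tuples. Different choices of \<phi> give multiple zeta values, polylogarithms
  and the multiple zeta series.\<close>

lemma infsum_incr_tuples_Suc:
  fixes \<phi> :: "nat \<Rightarrow> 'a :: {banach, real_normed_field}"
  assumes "summable (\<lambda>n. hsum (rev ls) (Suc n) * norm (\<phi> (Suc n)))"
  shows "(\<Sum>\<^sub>\<infinity>ms\<in>incr_tuples (Suc (length ls)). \<phi> (last ms) / of_nat (tuple_weight ls ms)) =
    (\<Sum>n. of_real (hsum (rev ls) (Suc n)) * \<phi> (Suc n))"
proof -
  let ?r = "length ls"
  let ?w = "\<lambda>ms. of_nat (tuple_weight ls ms) :: 'a"
  let ?f = "\<lambda>m ms. \<phi> m / ?w ms"
  have wt: "tuple_weight ls (ms @ [m]) = tuple_weight ls ms" if "ms \<in> tuples_below ?r m" for ms m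
    using that by (auto simp: tuples_below_def incr_tuples_def nth_append intro!: prod.cong)
  have inner: "(\<Sum>\<^sub>\<infinity>ms\<in>tuples_below ?r m. ?f m ms) = of_real (hsum (rev ls) m) * \<phi> m" for m
  proof -
    have "(\<Sum>\<^sub>\<infinity>ms\<in>tuples_below ?r m. ?f m ms) = of_real (\<Sum>ms\<in>tuples_below ?r m. 1 / real (tuple_weight ls ms)) * \<phi> m"
      by (simp add: infsum_finite finite_tuples_below sum_distrib_right)
    then show ?thesis
      by (simp only: sum_tuples_below)
  qed
  have inner_norm: "(\<Sum>\<^sub>\<infinity>ms\<in>tuples_below ?r m. norm (?f m ms)) = hsum (rev ls) m * norm (\<phi> m)" for m
  proof -
    have "(\<Sum>\<^sub>\<infinity>ms\<in>tuples_below ?r m. norm (?f m ms)) = (\<Sum>ms\<in>tuples_below ?r m. 1 / real (tuple_weight ls ms)) * norm (\<phi> m)"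
      by (simp add: infsum_finite finite_tuples_below sum_distrib_right norm_divide norm_power prod_norm[symmetric])
    then show ?thesis
      by (simp only: sum_tuples_below)
  qed
  have abs: "(\<lambda>m. hsum (rev ls) m * norm (\<phi> m)) summable_on {1..}"
  proof -
    have "(\<lambda>n. hsum (rev ls) (Suc n) * norm (\<phi> (Suc n))) summable_on UNIV"
      using assms by (intro norm_summable_imp_summable_on) (simp add: hsum_nonneg)
    then show ?thesis
      by (subst (asm) summable_on_reindex[of Suc UNIV "\<lambda>m. hsum (rev ls) m * norm (\<phi> m)", unfolded o_def, symmetric])
         (auto simp: range_Suc)
  qed
  have sig: "(\<lambda>(m, ms). ?f m ms) summable_on (SIGMA m:{1..}. tuples_below ?r m)"
  proof -
    define F where "F = (\<lambda>(m, ms). ?f m ms)"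
    have F: "(\<Sum>\<^sub>\<infinity>ms\<in>tuples_below ?r m. norm (F (m, ms))) = hsum (rev ls) m * norm (\<phi> m)" for m
      using inner_norm[of m] by (simp add: F_def)
    have "(\<lambda>x. norm (F x)) summable_on (SIGMA m:{1..}. tuples_below ?r m)"
      by (rule iffD2[OF Infinite_Sum.abs_summable_on_Sigma_iff])
         (use abs in \<open>simp add: F finite_tuples_below hsum_nonneg\<close>)
    then show ?thesis
      unfolding F_def by (rule Infinite_Sum.abs_summable_summable)
  qed
  have "(\<Sum>\<^sub>\<infinity>ms\<in>incr_tuples (Suc ?r). \<phi> (last ms) / ?w ms) =
        (\<Sum>\<^sub>\<infinity>(m, ms)\<in>(SIGMA m:{1..}. tuples_below ?r m). \<phi> m / ?w (ms @ [m]))"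
    by (subst infsum_reindex_bij_betw[OF bij_betw_snoc_incr_tuples, symmetric]) (simp add: case_prod_unfold)
  also have "\<dots> = (\<Sum>\<^sub>\<infinity>(m, ms)\<in>(SIGMA m:{1..}. tuples_below ?r m). ?f m ms)"
  proof (rule infsum_cong, clarify)
    fix m ms assume "ms \<in> tuples_below ?r m"
    then show "\<phi> m / ?w (ms @ [m]) = ?f m ms"
      by (simp only: wt)
  qed
  also have "\<dots> = (\<Sum>\<^sub>\<infinity>m\<in>{1..}. \<Sum>\<^sub>\<infinity>ms\<in>tuples_below ?r m. ?f m ms)"
    by (rule infsum_Sigma'_banach[symmetric, OF sig])
  also have "\<dots> = (\<Sum>\<^sub>\<infinity>m\<in>{1..}. of_real (hsum (rev ls) m) * \<phi> m)"
    by (simp only: inner)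
  also have "\<dots> = (\<Sum>\<^sub>\<infinity>n. of_real (hsum (rev ls) (Suc n)) * \<phi> (Suc n))"
    unfolding range_Suc[symmetric] by (subst infsum_reindex) (auto simp: o_def)
  also have "\<dots> = (\<Sum>n. of_real (hsum (rev ls) (Suc n)) * \<phi> (Suc n))"
  proof (rule infsumI, rule norm_summable_imp_has_sum)
    show "summable (\<lambda>n. norm (of_real (hsum (rev ls) (Suc n)) * \<phi> (Suc n)))"
      using assms by (simp add: norm_mult hsum_nonneg)
    then show "(\<lambda>n. of_real (hsum (rev ls) (Suc n)) * \<phi> (Suc n)) sums
        (\<Sum>n. of_real (hsum (rev ls) (Suc n)) * \<phi> (Suc n))"
      by (rule summable_sums[OF summable_norm_cancel])
  qed
  finally show ?thesis .
qed

subsection \<open>Products of multiple zeta values\<close>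

text \<open>The quasi-shuffle of two nested sums: the larger of the two leading variables goes
  first; if they coincide, they merge and their exponents add.\<close>

fun stuffle :: "nat list \<Rightarrow> nat list \<Rightarrow> nat list list" where
  "stuffle [] ys = [ys]"
| "stuffle (x # xs) [] = [x # xs]"
| "stuffle (x # xs) (y # ys) =
     map ((#) x) (stuffle xs (y # ys)) @ map ((#) y) (stuffle (x # xs) ys) @
     map ((#) (x + y)) (stuffle xs ys)"

lemma sum_list_map_Cons_hsum:
  assumes "n \<ge> 1"
  shows "(\<Sum>zs\<leftarrow>map ((#) a) zss. hsum zs (Suc n)) =
    (\<Sum>zs\<leftarrow>map ((#) a) zss. hsum zs n) + (\<Sum>zs\<leftarrow>zss. hsum zs n) / real n ^ a"
  using assms by (induction zss) (simp_all add: hsum_Cons_Suc field_simps)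

text \<open>Passing from \<open>n\<close> to \<open>Suc n\<close> adds an increment to each factor,
  and the three new terms of (a + u)(b + v) are the three branches of \<open>stuffle\<close>, known
  for shorter lists.\<close>

lemma hsum_mult: "hsum xs n * hsum ys n = (\<Sum>zs\<leftarrow>stuffle xs ys. hsum zs n)"
proof (induction xs ys arbitrary: n rule: stuffle.induct)
  case (3 x xs y ys)
  show ?case
  proof (induction n)
    case 0
    then show ?case
      by (simp add: o_def)
  next
    case (Suc n)
    show ?case
    proof (cases "n = 0")
      case True
      then show ?thesis
        by (simp add: o_def)
    next
      case False
      then have n: "n \<ge> 1"
        by simp
      have "hsum (x # xs) (Suc n) * hsum (y # ys) (Suc n) =
        hsum (x # xs) n * hsum (y # ys) n + (hsum xs n * hsum (y # ys) n) / real n ^ x +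
        (hsum (x # xs) n * hsum ys n) / real n ^ y + (hsum xs n * hsum ys n) / real n ^ (x + y)"
        using n by (simp add: hsum_Cons_Suc power_add field_simps)
      also have "\<dots> = (\<Sum>zs\<leftarrow>stuffle (x # xs) (y # ys). hsum zs (Suc n))"
        unfolding 3(1)[of n] 3(2)[of n] 3(3)[of n] Suc.IH stuffle.simps map_append sum_list.append
          sum_list_map_Cons_hsum[OF n] by simp
      finally show ?thesis .
    qed
  qed
qed simp_all

definition admissible_rev :: "nat list \<Rightarrow> bool" where
  "admissible_rev ks \<longleftrightarrow> is_index ks \<and> (ks \<noteq> [] \<longrightarrow> hd ks \<ge> 2)"

lemma is_index_Cons [simp]: "is_index (k # ks) \<longleftrightarrow> k \<ge> 1 \<and> is_index ks"
  by (auto simp: is_index_def)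

lemma is_index_Nil [simp]: "is_index []"
  by (simp add: is_index_def)

lemma is_index_rev [simp]: "is_index (rev ks) \<longleftrightarrow> is_index ks"
  by (simp add: is_index_def)

lemma stuffle_is_index:
  assumes "is_index xs" "is_index ys"
  shows "\<forall>zs\<in>set (stuffle xs ys). is_index zs"
  using assms
proof (induction xs ys rule: stuffle.induct)
  case (3 x xs y ys)
  have idx: "x \<ge> 1" "y \<ge> 1" "is_index xs" "is_index ys"
    using "3.prems" by simp_all
  have 1: "\<forall>zs\<in>set (stuffle xs (y # ys)). is_index zs"
    using idx by (intro "3.IH"(1)) simp_all
  have 2: "\<forall>zs\<in>set (stuffle (x # xs) ys). is_index zs"
    using idx by (intro "3.IH"(2)) simp_all
  have 3: "\<forall>zs\<in>set (stuffle xs ys). is_index zs"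
    using idx by (intro "3.IH"(3)) simp_all
  show ?case
    using 1 2 3 idx(1,2) by auto
qed simp_all

lemma sum_list_stuffle: "zs \<in> set (stuffle xs ys) \<Longrightarrow> sum_list zs = sum_list xs + sum_list ys"
  by (induction xs ys arbitrary: zs rule: stuffle.induct) auto

text \<open>A new head is one of the old heads or their sum, so it stays at least 2.\<close>

lemma stuffle_admissible:
  "admissible_rev xs \<Longrightarrow> admissible_rev ys \<Longrightarrow> zs \<in> set (stuffle xs ys) \<Longrightarrow> admissible_rev zs"
  using stuffle_is_index[of xs ys]
  by (cases "(xs, ys)" rule: stuffle.cases) (auto simp: admissible_rev_def)

lemma mzv_rev_Cons:
  assumes "is_index ks" "k \<ge> 2"
  shows "mzv (rev (k # ks)) = (\<Sum>n. hsum ks (Suc n) / real (Suc n) ^ k)"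
proof -
  have eq: "(\<Prod>i<length (rev (k # ks)). real (ms ! i) ^ (rev (k # ks) ! i)) =
      real (tuple_weight (rev ks) ms) * real (last ms) ^ k"
    if "ms \<in> incr_tuples (Suc (length (rev ks)))" for ms
  proof -
    have "ms \<noteq> []" "length ms = Suc (length ks)"
      using that by (auto simp: incr_tuples_def)
    then have "ms ! length ks = last ms"
      by (simp add: last_conv_nth)
    then show ?thesis
      by (auto simp: nth_append intro!: prod.cong)
  qed
  have "mzv (rev (k # ks)) = (\<Sum>\<^sub>\<infinity>ms\<in>incr_tuples (Suc (length (rev ks))).
      1 / (\<Prod>i<length (rev (k # ks)). real (ms ! i) ^ (rev (k # ks) ! i)))"
    by (simp only: mzv_def length_rev list.size add_Suc_right add_0_right)
  also have "\<dots> = (\<Sum>\<^sub>\<infinity>ms\<in>incr_tuples (Suc (length (rev ks))).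
      (1 / real (last ms) ^ k) / real (tuple_weight (rev ks) ms))"
    by (rule infsum_cong) (simp only: eq divide_divide_eq_left mult.commute)
  also have "\<dots> = (\<Sum>n. of_real (hsum (rev (rev ks)) (Suc n)) * (1 / real (Suc n) ^ k))"
    using summable_hsum_power[OF assms]
    by (subst infsum_incr_tuples_Suc) (simp_all add: norm_divide norm_power del: of_nat_Suc)
  finally show ?thesis
    by simp
qed

lemma hsum_LIMSEQ_mzv:
  assumes "admissible_rev ks"
  shows "(\<lambda>n. hsum ks (Suc n)) \<longlonglongrightarrow> mzv (rev ks)"
proof (cases ks)
  case (Cons k ks')
  then have k: "is_index ks'" "k \<ge> 2"
    using assms by (auto simp: admissible_rev_def)
  have "hsum ks (Suc n) = (\<Sum>i<n. hsum ks' (Suc i) / real (Suc i) ^ k)" for n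
  proof -
    have "{1..<Suc n} = Suc ` {..<n}"
      by (simp add: lessThan_atLeast0)
    then show ?thesis
      by (simp add: Cons hsum.simps(2) sum.reindex)
  qed
  then show ?thesis
    using summable_LIMSEQ[OF summable_hsum_power[OF k]] mzv_rev_Cons[OF k] by (simp add: Cons)
qed (simp add: mzv_Nil)

text \<open>The finite product formula passes to the limit term by term because every term of the
  stuffle is again admissible.\<close>

lemma mzv_mult:
  assumes "admissible_rev xs" "admissible_rev ys"
  shows "mzv (rev xs) * mzv (rev ys) = (\<Sum>zs\<leftarrow>stuffle xs ys. mzv (rev zs))"
proof (rule LIMSEQ_unique)
  show "(\<lambda>n. hsum xs (Suc n) * hsum ys (Suc n)) \<longlonglongrightarrow> mzv (rev xs) * mzv (rev ys)"
    by (intro tendsto_intros hsum_LIMSEQ_mzv assms)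
  have "(\<lambda>n. \<Sum>zs\<leftarrow>zss. hsum zs (Suc n)) \<longlonglongrightarrow> (\<Sum>zs\<leftarrow>zss. mzv (rev zs))"
    if "\<forall>zs\<in>set zss. admissible_rev zs" for zss
    using that by (induction zss) (auto intro!: tendsto_intros hsum_LIMSEQ_mzv)
  then show "(\<lambda>n. hsum xs (Suc n) * hsum ys (Suc n)) \<longlonglongrightarrow> (\<Sum>zs\<leftarrow>stuffle xs ys. mzv (rev zs))"
    unfolding hsum_mult using stuffle_admissible[OF assms] by blast
qed

section \<open>The rational spans of multiple zeta values, graded by weight\<close>

abbreviation mzv_span :: "nat \<Rightarrow> real set" where
  "mzv_span w \<equiv> rat_span (mzvs_of_weight w)"

interpretation rat: module "\<lambda>(q::rat) (x::real). of_rat q * x"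
  by (rule module_rat_real)

lemma mzvs_of_weight_eq: "mzvs_of_weight w = {mzv (rev ks) | ks. admissible_rev ks \<and> sum_list ks = w}"
proof (intro equalityI subsetI)
  fix x assume "x \<in> mzvs_of_weight w"
  then obtain ls where "x = mzv ls" "is_index ls" "ls \<noteq> [] \<longrightarrow> last ls \<ge> 2" "sum_list ls = w"
    by (auto simp: mzvs_of_weight_def)
  then show "x \<in> {mzv (rev ks) | ks. admissible_rev ks \<and> sum_list ks = w}"
    by (intro CollectI exI[of _ "rev ls"]) (auto simp: admissible_rev_def hd_rev)
next
  fix x assume "x \<in> {mzv (rev ks) | ks. admissible_rev ks \<and> sum_list ks = w}"
  then obtain ks where "x = mzv (rev ks)" "admissible_rev ks" "sum_list ks = w"
    by auto
  then show "x \<in> mzvs_of_weight w"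
    unfolding mzvs_of_weight_def
    by (intro CollectI exI[of _ "rev ks"]) (auto simp: admissible_rev_def last_rev)
qed

lemma mzv_in_mzv_span: "admissible_rev ks \<Longrightarrow> mzv (rev ks) \<in> mzv_span (sum_list ks)"
  unfolding rat_span_def mzvs_of_weight_eq by (intro rat.span_base) blast

lemma mzv_span_add: "x \<in> mzv_span w \<Longrightarrow> y \<in> mzv_span w \<Longrightarrow> x + y \<in> mzv_span w"
  unfolding rat_span_def by (rule rat.span_add)

lemma mzv_span_uminus: "x \<in> mzv_span w \<Longrightarrow> - x \<in> mzv_span w"
  unfolding rat_span_def by (rule rat.span_neg)

lemma mzv_span_0: "0 \<in> mzv_span w"
  unfolding rat_span_def by (rule rat.span_zero)

lemma mzv_span_sum: "(\<And>i. i \<in> I \<Longrightarrow> f i \<in> mzv_span w) \<Longrightarrow> sum f I \<in> mzv_span w"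
  unfolding rat_span_def by (rule rat.span_sum)

lemma mzv_span_sum_list:
  "(\<And>i. i \<in> set is \<Longrightarrow> f i \<in> mzv_span w) \<Longrightarrow> (\<Sum>i\<leftarrow>is. f i) \<in> mzv_span w"
  by (induction "is") (auto simp: mzv_span_0 intro: mzv_span_add)

lemma mzv_span_1: "1 \<in> mzv_span 0"
  using mzv_in_mzv_span[of "[]"] by (simp add: admissible_rev_def mzv_Nil)

text \<open>Bilinear extension of the product formula from the generators, by one induction over
  linear combinations in each factor.\<close>

lemma mzv_span_mult:
  assumes "x \<in> mzv_span v" "y \<in> mzv_span w"
  shows "x * y \<in> mzv_span (v + w)"
proof -
  have gen: "a * b \<in> mzv_span (v + w)" if "a \<in> mzvs_of_weight v" "b \<in> mzvs_of_weight w" for a b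
  proof -
    from that obtain xs ys where
      "a = mzv (rev xs)" "b = mzv (rev ys)" and adm: "admissible_rev xs" "admissible_rev ys"
      and wt: "sum_list xs = v" "sum_list ys = w"
      unfolding mzvs_of_weight_eq by blast
    then have "a * b = (\<Sum>zs\<leftarrow>stuffle xs ys. mzv (rev zs))"
      by (simp add: mzv_mult)
    moreover have "mzv (rev zs) \<in> mzv_span (v + w)" if "zs \<in> set (stuffle xs ys)" for zs
      using mzv_in_mzv_span[of zs] stuffle_admissible[OF adm that] sum_list_stuffle[OF that] wt by simp
    ultimately show ?thesis
      using mzv_span_sum_list[of "stuffle xs ys" "\<lambda>zs. mzv (rev zs)" "v + w"] by simp
  qed
  have sc: "of_rat q * z \<in> mzv_span (v + w)" if "z \<in> mzv_span (v + w)" for q z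
    using that unfolding rat_span_def by (rule rat.span_scale)
  have 1: "a * y \<in> mzv_span (v + w)" if "a \<in> mzvs_of_weight v" for a
    using assms(2)[unfolded rat_span_def]
  proof (induction rule: rat.span_induct_alt)
    case (step c b z)
    have "of_rat c * (a * b) + a * z \<in> mzv_span (v + w)"
      by (intro mzv_span_add sc gen that step)
    then show ?case
      by (simp add: algebra_simps)
  qed (simp add: mzv_span_0)
  show ?thesis
    using assms(1)[unfolded rat_span_def]
  proof (induction rule: rat.span_induct_alt)
    case (step c b z)
    have "of_rat c * (b * y) + z * y \<in> mzv_span (v + w)"
      by (intro mzv_span_add sc 1 step)
    then show ?case
      by (simp add: algebra_simps)
  qed (simp add: mzv_span_0)
qed

subsection \<open>Multiple polylogarithms on the unit interval\<close>

text \<open>The exponent 0 is allowed for \<open>k\<close>. In that case, with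
  \<open>ks = []\<close>, the quotient at n = 0 would be 1, so the constant term has to be set to 0
  by hand.\<close>

definition polylog_coeff :: "nat \<Rightarrow> nat list \<Rightarrow> nat \<Rightarrow> real" where
  "polylog_coeff k ks n = (if n = 0 then 0 else hsum ks n / real n ^ k)"

fun polylog :: "nat list \<Rightarrow> real \<Rightarrow> real" where
  "polylog [] x = 1"
| "polylog (k # ks) x = (\<Sum>n. polylog_coeff k ks n * x ^ n)"

declare polylog.simps(2) [simp del]

lemma polylog_coeff_nonneg: "polylog_coeff k ks n \<ge> 0"
  by (simp add: polylog_coeff_def hsum_nonneg)

lemma polylog_coeff_0 [simp]: "polylog_coeff k ks 0 = 0"
  by (simp add: polylog_coeff_def)

lemma polylog_coeff_Suc: "polylog_coeff k ks (Suc n) = hsum ks (Suc n) / real (Suc n) ^ k"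
  by (simp add: polylog_coeff_def)

lemma polylog_at_0 [simp]: "polylog (k # ks) 0 = 0"
  by (simp add: polylog.simps(2) powser_zero)

lemma polylog_coeff_bound:
  assumes "is_index ks"
  obtains C where "C \<ge> 0" "\<And>k n. polylog_coeff k ks n \<le> C * real n"
proof -
  obtain C where C: "C \<ge> 0" "\<And>n. n \<ge> 1 \<Longrightarrow> hsum ks n \<le> C * real n powr 1"
    using hsum_bound[OF assms, of 1] by auto
  have "polylog_coeff k ks n \<le> C * real n" for k n
  proof (cases "n = 0")
    case False
    then have "hsum ks n / real n ^ k \<le> hsum ks n / 1"
      by (intro divide_left_mono) (auto simp: hsum_nonneg)
    then show ?thesis
      using C(2)[of n] False by (simp add: polylog_coeff_def)
  qed simp
  then show ?thesis
    using that C(1) by blast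
qed

lemma polylog_summable:
  assumes "is_index ks" "\<bar>x\<bar> < 1"
  shows "summable (\<lambda>n. polylog_coeff k ks n * x ^ n)"
proof -
  obtain C where C: "C \<ge> 0" "\<And>k n. polylog_coeff k ks n \<le> C * real n"
    using polylog_coeff_bound[OF assms(1)] by blast
  have "summable (\<lambda>n. real (Suc n) * \<bar>x\<bar> ^ n)"
    using geometric_deriv_sums[of "\<bar>x\<bar>"] assms by (auto simp: sums_iff)
  then have "summable (\<lambda>n. C * (real (Suc n) * \<bar>x\<bar> ^ n))"
    by (rule summable_mult)
  then show ?thesis
  proof (rule summable_comparison_test'[where N = 0])
    fix n
    have "polylog_coeff k ks n * \<bar>x\<bar> ^ n \<le> C * real (Suc n) * \<bar>x\<bar> ^ n"
      using C(2)[of k n] C(1) by (intro mult_right_mono) (auto simp: algebra_simps)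
    then show "norm (polylog_coeff k ks n * x ^ n) \<le> C * (real (Suc n) * \<bar>x\<bar> ^ n)"
      by (simp add: abs_mult power_abs polylog_coeff_nonneg)
  qed
qed

lemma polylog_sums:
  "is_index ks \<Longrightarrow> \<bar>x\<bar> < 1 \<Longrightarrow> (\<lambda>n. polylog_coeff k ks n * x ^ n) sums polylog (k # ks) x"
  using polylog_summable[of ks x k] by (simp add: polylog.simps(2) summable_sums)

lemma polylog_nonneg: "is_index ks \<Longrightarrow> 0 \<le> x \<Longrightarrow> x < 1 \<Longrightarrow> polylog ks x \<ge> 0"
  by (cases ks) (auto simp: polylog.simps(2) polylog_coeff_nonneg intro!: suminf_nonneg polylog_summable)

text \<open>For exponent 0 the coefficients are the sums \<open>hsum ks n\<close> themselves, and
  multiplication by 1 - x takes their differences. The identity absorbs the kernel 1/(1 - z) into a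
  polylogarithm divided by z, and likewise the factor 1/(exp t - 1) at x = exp(-t).\<close>

lemma polylog_Cons_0:
  assumes "is_index ks" "\<bar>x\<bar> < 1"
  shows "polylog (0 # ks) x = x / (1 - x) * polylog ks x"
proof (cases ks)
  case Nil
  have "(\<lambda>n. x * x ^ n) sums (x * (1 / (1 - x)))"
    using assms by (intro sums_mult geometric_sums) auto
  then have "(\<lambda>n. polylog_coeff 0 [] (Suc n) * x ^ Suc n) sums (x / (1 - x))"
    by (simp add: polylog_coeff_Suc)
  then have "(\<lambda>n. polylog_coeff 0 [] n * x ^ n) sums (x / (1 - x))"
    by (subst (asm) sums_Suc_iff) simp
  then show ?thesis
    using Nil by (simp add: polylog.simps(2) sums_iff)
next
  case (Cons k ls)
  have ls: "is_index ls"
    using assms Cons by simp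
  let ?c = "polylog_coeff 0 ks"
  have s: "(\<lambda>n. ?c n * x ^ n) sums polylog (0 # ks) x"
    by (rule polylog_sums) fact+
  then have "(\<lambda>n. ?c (Suc n) * x ^ Suc n) sums polylog (0 # ks) x"
    by (subst sums_Suc_iff) simp
  moreover have "(\<lambda>n. x * (?c n * x ^ n)) sums (x * polylog (0 # ks) x)"
    by (intro sums_mult s)
  ultimately have "(\<lambda>n. ?c (Suc n) * x ^ Suc n - x * (?c n * x ^ n)) sums
      (polylog (0 # ks) x - x * polylog (0 # ks) x)"
    by (rule sums_diff)
  also have "(\<lambda>n. ?c (Suc n) * x ^ Suc n - x * (?c n * x ^ n)) =
      (\<lambda>n. x * (polylog_coeff k ls n * x ^ n))"
  proof
    fix n
    have "?c (Suc n) = ?c n + polylog_coeff k ls n"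
      by (cases "n = 0") (auto simp: polylog_coeff_def Cons hsum_Cons_Suc)
    then show "?c (Suc n) * x ^ Suc n - x * (?c n * x ^ n) = x * (polylog_coeff k ls n * x ^ n)"
      by (simp add: algebra_simps)
  qed
  finally have "(\<lambda>n. x * (polylog_coeff k ls n * x ^ n)) sums
      (polylog (0 # ks) x - x * polylog (0 # ks) x)" .
  moreover have "(\<lambda>n. x * (polylog_coeff k ls n * x ^ n)) sums (x * polylog ks x)"
    unfolding Cons by (intro sums_mult polylog_sums ls assms)
  ultimately have "polylog (0 # ks) x - x * polylog (0 # ks) x = x * polylog ks x"
    by (rule sums_unique2)
  then show ?thesis
    using assms by (simp add: field_simps)
qed

lemma polylog_differentiable:
  assumes "is_index ks" "\<bar>x\<bar> < 1"
  shows "(polylog (k # ks) has_real_derivative (\<Sum>n. diffs (polylog_coeff k ks) n * x ^ n)) (at x)"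
proof -
  define K where "K = (\<bar>x\<bar> + 1) / 2"
  have "polylog (k # ks) = (\<lambda>x. \<Sum>n. polylog_coeff k ks n * x ^ n)"
    by (simp add: polylog.simps(2) fun_eq_iff)
  moreover have "((\<lambda>x. \<Sum>n. polylog_coeff k ks n * x ^ n) has_real_derivative
      (\<Sum>n. diffs (polylog_coeff k ks) n * x ^ n)) (at x)"
    using assms by (intro termdiffs_strong[of _ K] polylog_summable) (auto simp: K_def)
  ultimately show ?thesis
    by simp
qed

lemma DERIV_polylog:
  assumes "is_index ks" "\<bar>x\<bar> < 1" "x \<noteq> 0"
  shows "(polylog (Suc k # ks) has_real_derivative polylog (k # ks) x / x) (at x)"
proof -
  have "(\<lambda>n. polylog_coeff k ks (Suc n) * x ^ Suc n) sums polylog (k # ks) x"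
    using polylog_sums[OF assms(1,2), of k] by (subst sums_Suc_iff) simp
  then have "(\<lambda>n. polylog_coeff k ks (Suc n) * x ^ Suc n / x) sums (polylog (k # ks) x / x)"
    by (rule sums_divide)
  moreover have "polylog_coeff k ks (Suc n) * x ^ Suc n / x = diffs (polylog_coeff (Suc k) ks) n * x ^ n" for n
    using assms(3) by (simp add: diffs_def polylog_coeff_Suc field_simps del: of_nat_Suc)
  ultimately have "(\<Sum>n. diffs (polylog_coeff (Suc k) ks) n * x ^ n) = polylog (k # ks) x / x"
    by (simp add: sums_iff)
  then show ?thesis
    using polylog_differentiable[OF assms(1,2), of "Suc k"] by simp
qed

lemma isCont_polylog: "is_index ks \<Longrightarrow> \<bar>x\<bar> < 1 \<Longrightarrow> isCont (polylog ks) x"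
  by (cases ks) (auto simp: polylog.simps(1)[abs_def] intro: DERIV_isCont polylog_differentiable)

lemma polylog_at_1:
  assumes "is_index ks" "k \<ge> 2"
  shows "polylog (k # ks) 1 = mzv (rev (k # ks))"
proof -
  have "(\<lambda>n. polylog_coeff k ks (Suc n)) sums mzv (rev (k # ks))"
    using summable_sums[OF summable_hsum_power[OF assms]] mzv_rev_Cons[OF assms]
    by (simp add: polylog_coeff_Suc)
  then have "(\<lambda>n. polylog_coeff k ks n) sums mzv (rev (k # ks))"
    by (subst (asm) sums_Suc_iff) simp
  then show ?thesis
    by (simp add: polylog.simps(2) sums_iff)
qed

text \<open>For \<open>k \<ge> 2\<close> the coefficients are summable and dominate the terms on the
  closed interval, so convergence is uniform up to the endpoint 1.\<close>

lemma continuous_on_polylog: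
  assumes "is_index ks" "k \<ge> 2"
  shows "continuous_on {0..1} (polylog (k # ks))"
proof -
  have "uniform_limit {0..1} (\<lambda>n x. \<Sum>i<n. polylog_coeff k ks i * x ^ i)
      (\<lambda>x. \<Sum>i. polylog_coeff k ks i * x ^ i) sequentially"
  proof (rule Weierstrass_m_test)
    show "norm (polylog_coeff k ks n * x ^ n) \<le> polylog_coeff k ks n" if "x \<in> {0..1}" for n x
      using that by (auto simp: abs_mult polylog_coeff_nonneg power_le_one intro!: mult_left_le)
    show "summable (polylog_coeff k ks)"
      using summable_hsum_power[OF assms] unfolding polylog_coeff_Suc[symmetric]
      by (simp only: summable_Suc_iff)
  qed
  then have "continuous_on {0..1} (\<lambda>x. \<Sum>i. polylog_coeff k ks i * x ^ i)"
    by (rule uniform_limit_theorem[rotated]) (auto intro!: always_eventually continuous_intros)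
  then show ?thesis
    by (simp add: polylog.simps(2)[abs_def])
qed

lemma polylog_tendsto_mzv:
  assumes "is_index ks" "k \<ge> 2"
  shows "(polylog (k # ks) \<longlongrightarrow> mzv (rev (k # ks))) (at_left 1)"
proof -
  have "(polylog (k # ks) \<longlongrightarrow> polylog (k # ks) 1) (at 1 within {0..1})"
    using continuous_on_polylog[OF assms] by (auto simp: continuous_on_def)
  then have "(polylog (k # ks) \<longlongrightarrow> polylog (k # ks) 1) (at_left 1)"
    by (simp add: at_within_Icc_at_left)
  then show ?thesis
    by (simp only: polylog_at_1[OF assms])
qed

subsection \<open>Primitives of products with powers of the logarithm\<close>

text \<open>Dividing by j! removes all constants from differentiation and integration. At z =
  exp(-t) the value is t^j / j!, and this factorial later becomes the denominator of the binomial
  coefficient.\<close>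

definition logpow :: "nat \<Rightarrow> real \<Rightarrow> real" where
  "logpow j z = (- ln z) ^ j / fact j"

lemma logpow_0 [simp]: "logpow 0 z = 1"
  by (simp add: logpow_def)

lemma DERIV_logpow:
  assumes "z > 0"
  shows "(logpow (Suc j) has_real_derivative - logpow j z / z) (at z)"
proof -
  have "((\<lambda>z. (- ln z) ^ Suc j / fact (Suc j)) has_real_derivative
      (real (Suc j) * (- ln z) ^ j * (- (1 / z))) / fact (Suc j)) (at z)"
    using assms by (auto intro!: derivative_eq_intros simp del: power_Suc fact_Suc)
  moreover have "(real (Suc j) * (- ln z) ^ j * (- (1 / z))) / fact (Suc j) = - logpow j z / z"
    by (simp add: logpow_def field_simps del: of_nat_Suc)
  ultimately show ?thesis
    by (simp add: logpow_def[abs_def] mult.commute)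
qed

lemma logpow_tendsto_0_at_left_1:
  assumes "j > 0"
  shows "(logpow j \<longlongrightarrow> 0) (at_left 1)"
proof -
  have "(logpow j \<longlongrightarrow> (- ln 1) ^ j / fact j) (at_left 1)"
    unfolding logpow_def by (intro tendsto_intros) auto
  with assms show ?thesis
    by (simp add: power_0_left)
qed

lemma mult_logpow_tendsto_0: "((\<lambda>z. z * logpow j z) \<longlongrightarrow> 0) (at_right 0)"
proof -
  have "filterlim (\<lambda>z::real. - ln z) at_top (at_right 0)"
    using ln_at_0 by (simp add: filterlim_uminus_at_top)
  then have "((\<lambda>z::real. (- ln z) ^ j / exp (- ln z)) \<longlongrightarrow> 0) (at_right 0)"
    by (rule filterlim_compose[OF tendsto_power_div_exp_0])
  then have "((\<lambda>z::real. (- ln z) ^ j / exp (- ln z) / fact j) \<longlongrightarrow> 0 / fact j) (at_right 0)"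
    by (intro tendsto_intros) auto
  then have "((\<lambda>z::real. (- ln z) ^ j / exp (- ln z) / fact j) \<longlongrightarrow> 0) (at_right 0)"
    by simp
  then show ?thesis
  proof (rule Lim_transform_eventually)
    show "eventually (\<lambda>z::real. (- ln z) ^ j / exp (- ln z) / fact j = z * logpow j z) (at_right 0)"
      using eventually_at_right_less[of "0::real"]
      by eventually_elim (simp add: logpow_def exp_minus field_simps)
  qed
qed

text \<open>A polylogarithm of positive depth vanishes to first order at 0, which beats any power of
  the logarithm.\<close>

lemma logpow_polylog_tendsto_0:
  assumes "is_index ks"
  shows "((\<lambda>z. logpow j z * polylog (k # ks) z) \<longlongrightarrow> 0) (at_right 0)"
proof -
  define D where "D = (\<Sum>n. diffs (polylog_coeff k ks) n * 0 ^ n)"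
  have "(polylog (k # ks) has_real_derivative D) (at 0)"
    unfolding D_def by (rule polylog_differentiable[OF assms]) simp
  then have "((\<lambda>h. polylog (k # ks) h / h) \<longlongrightarrow> D) (at 0)"
    by (simp add: DERIV_def)
  then have "((\<lambda>h. polylog (k # ks) h / h) \<longlongrightarrow> D) (at_right 0)"
    by (rule tendsto_within_subset) simp
  from tendsto_mult[OF mult_logpow_tendsto_0[of j] this]
  have "((\<lambda>z. z * logpow j z * (polylog (k # ks) z / z)) \<longlongrightarrow> 0) (at_right 0)"
    by simp
  then show ?thesis
  proof (rule Lim_transform_eventually)
    show "eventually (\<lambda>z. z * logpow j z * (polylog (k # ks) z / z) = logpow j z * polylog (k # ks) z) (at_right 0)"
      using eventually_at_right_less[of "0::real"] by eventually_elim simp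
  qed
qed

text \<open>Repeated integration by parts, integrating the polylogarithm and differentiating the logarithm.\<close>

fun prim :: "nat \<Rightarrow> nat list \<Rightarrow> nat \<Rightarrow> real \<Rightarrow> real" where
  "prim k ks 0 z = polylog (k # ks) z"
| "prim k ks (Suc j) z = logpow (Suc j) z * polylog (k # ks) z + prim (Suc k) ks j z"

text \<open>The derivative of the logarithmic factor cancels the derivative of the remaining
  primitive. The case k = 0 is included; it is the one that serves the kernel 1/(1 - z).\<close>

lemma DERIV_prim:
  assumes "is_index ks" "z \<in> {0<..<1}"
  shows "(prim (Suc k) ks j has_real_derivative logpow j z * (polylog (k # ks) z / z)) (at z)"
proof (induction j arbitrary: k)
  case 0
  have "prim (Suc k) ks 0 = polylog (Suc k # ks)"
    by (simp add: fun_eq_iff)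
  then show ?case
    using DERIV_polylog[OF assms(1), of z k] assms(2) by simp
next
  case (Suc j)
  have "((\<lambda>z. logpow (Suc j) z * polylog (Suc k # ks) z + prim (Suc (Suc k)) ks j z) has_real_derivative
      (- logpow j z / z) * polylog (Suc k # ks) z + (polylog (k # ks) z / z) * logpow (Suc j) z +
      logpow j z * (polylog (Suc k # ks) z / z)) (at z)"
    using assms by (intro DERIV_add DERIV_mult DERIV_logpow DERIV_polylog Suc.IH) auto
  moreover have "prim (Suc k) ks (Suc j) =
      (\<lambda>z. logpow (Suc j) z * polylog (Suc k # ks) z + prim (Suc (Suc k)) ks j z)"
    by (simp add: fun_eq_iff)
  ultimately show ?case
    by (simp add: mult.commute)
qed

lemma prim_tendsto_0:
  assumes "is_index ks"
  shows "(prim k ks j \<longlongrightarrow> 0) (at_right 0)"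
proof (induction j arbitrary: k)
  case 0
  then show ?case
    using logpow_polylog_tendsto_0[OF assms, of 0 k] by simp
next
  case (Suc j)
  then show ?case
    using tendsto_add[OF logpow_polylog_tendsto_0[OF assms, of "Suc j" k] Suc.IH] by simp
qed

text \<open>Positive powers of the logarithm vanish at 1, so only the last polylogarithm survives,
  whose leading exponent has been raised \<open>j\<close> times.\<close>

lemma prim_tendsto_mzv:
  assumes "is_index ks" "k \<ge> 2"
  shows "(prim k ks j \<longlongrightarrow> mzv (rev ((k + j) # ks))) (at_left 1)"
  using assms(2)
proof (induction j arbitrary: k)
  case 0
  then show ?case
    using polylog_tendsto_mzv[OF assms(1), of k] by simp
next
  case (Suc j)
  have "((\<lambda>z. logpow (Suc j) z * polylog (k # ks) z + prim (Suc k) ks j z) \<longlongrightarrow>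
      0 * mzv (rev (k # ks)) + mzv (rev ((Suc k + j) # ks))) (at_left 1)"
    by (intro tendsto_intros logpow_tendsto_0_at_left_1 polylog_tendsto_mzv assms Suc) (use Suc.prems in auto)
  then show ?case
    by simp
qed

subsection \<open>The connection formula\<close>

text \<open>Homogeneity is encoded in the span to which each coefficient belongs; the subtraction
  there is exact because the pair lies in \<open>index_pairs w\<close>. All combinations of one
  weight share this finite index set, so they are added coefficientwise.\<close>

definition polylog_combination :: "nat \<Rightarrow> (real \<Rightarrow> real) \<Rightarrow> bool" where
  "polylog_combination w f \<longleftrightarrow> (\<exists>c.
     (\<forall>(ls, j)\<in>index_pairs w. c ls j \<in> mzv_span (w - sum_list ls - j)) \<and>
     (\<forall>z\<in>{0<..<1}. f z = (\<Sum>(ls, j)\<in>index_pairs w. c ls j * logpow j z * polylog (rev ls) z)))"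

lemma index_pairs_iff: "(ls, j) \<in> index_pairs w \<longleftrightarrow> is_index ls \<and> sum_list ls + j \<le> w"
  by (simp add: index_pairs_def)

lemma polylog_combination_cong:
  assumes "polylog_combination w f" "\<And>z. z \<in> {0<..<1} \<Longrightarrow> g z = f z"
  shows "polylog_combination w g"
  using assms unfolding polylog_combination_def by simp

lemma polylog_combination_add:
  assumes "polylog_combination w f" "polylog_combination w g"
  shows "polylog_combination w (\<lambda>z. f z + g z)"
proof -
  obtain c where c: "\<And>ls j. (ls, j) \<in> index_pairs w \<Longrightarrow> c ls j \<in> mzv_span (w - sum_list ls - j)"
    "\<And>z. z \<in> {0<..<1} \<Longrightarrow> f z = (\<Sum>(ls, j)\<in>index_pairs w. c ls j * logpow j z * polylog (rev ls) z)"
    using assms(1) unfolding polylog_combination_def by force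
  obtain d where d: "\<And>ls j. (ls, j) \<in> index_pairs w \<Longrightarrow> d ls j \<in> mzv_span (w - sum_list ls - j)"
    "\<And>z. z \<in> {0<..<1} \<Longrightarrow> g z = (\<Sum>(ls, j)\<in>index_pairs w. d ls j * logpow j z * polylog (rev ls) z)"
    using assms(2) unfolding polylog_combination_def by force
  have "f z + g z = (\<Sum>(ls, j)\<in>index_pairs w. (c ls j + d ls j) * logpow j z * polylog (rev ls) z)"
    if "z \<in> {0<..<1}" for z
    using that by (simp add: c(2) d(2) sum.distrib[symmetric] algebra_simps case_prod_unfold)
  moreover have "\<forall>(ls, j)\<in>index_pairs w. c ls j + d ls j \<in> mzv_span (w - sum_list ls - j)"
    using c(1) d(1) mzv_span_add by blast
  ultimately show ?thesis
    unfolding polylog_combination_def by (intro exI[of _ "\<lambda>ls j. c ls j + d ls j"]) blast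
qed

lemma polylog_combination_monom:
  assumes "is_index ks" "x \<in> mzv_span v" "w = v + sum_list ks + j"
  shows "polylog_combination w (\<lambda>z. x * logpow j z * polylog ks z)"
proof -
  define c where "c = (\<lambda>ls i. if ls = rev ks \<and> i = j then x else 0)"
  have mem: "(rev ks, j) \<in> index_pairs w"
    using assms by (simp add: index_pairs_iff)
  have "(\<Sum>(ls, i)\<in>index_pairs w. c ls i * logpow i z * polylog (rev ls) z) =
      (\<Sum>p\<in>index_pairs w. if p = (rev ks, j) then x * logpow j z * polylog ks z else 0)" for z
    by (intro sum.cong refl) (auto simp: c_def split: if_splits)
  then have "(\<Sum>(ls, i)\<in>index_pairs w. c ls i * logpow i z * polylog (rev ls) z) = x * logpow j z * polylog ks z" for z
    using mem by (simp add: finite_index_pairs)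
  moreover have "\<forall>(ls, i)\<in>index_pairs w. c ls i \<in> mzv_span (w - sum_list ls - i)"
    using assms by (auto simp: c_def mzv_span_0)
  ultimately show ?thesis
    unfolding polylog_combination_def by (intro exI[of _ c]) simp
qed

lemma polylog_combination_0: "polylog_combination w (\<lambda>_. 0)"
  using polylog_combination_monom[of "[]" 0 w w 0] by (simp add: mzv_span_0)

lemma polylog_combination_sum:
  "finite I \<Longrightarrow> (\<And>i. i \<in> I \<Longrightarrow> polylog_combination w (f i)) \<Longrightarrow> polylog_combination w (\<lambda>z. \<Sum>i\<in>I. f i z)"
  by (induction I rule: finite_induct) (auto intro: polylog_combination_0 polylog_combination_add)

text \<open>Each integration by parts moves one unit of weight from the logarithm to the leading
  exponent, so all terms have the same total weight.\<close>

lemma polylog_combination_prim: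
  assumes "is_index ks" "x \<in> mzv_span v" "k \<ge> 1" "w = v + k + sum_list ks + j"
  shows "polylog_combination w (\<lambda>z. x * prim k ks j z)"
  using assms(3,4)
proof (induction j arbitrary: k)
  case 0
  then show ?case
    using polylog_combination_monom[of "k # ks" x v w 0] assms by simp
next
  case (Suc j)
  have "polylog_combination w (\<lambda>z. x * logpow (Suc j) z * polylog (k # ks) z)"
    using assms Suc.prems by (intro polylog_combination_monom) auto
  moreover have "polylog_combination w (\<lambda>z. x * prim (Suc k) ks j z)"
    using Suc.prems by (intro Suc.IH) auto
  ultimately show ?case
    by (rule polylog_combination_cong[OF polylog_combination_add]) (simp add: algebra_simps)
qed

text \<open>
  Both steps integrate a connection formula; the constant of integration is found at
  \<open>z = 0\<close> and at \<open>z = 1\<close>, respectively, whichever endpoint gives a finite value term by term.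
\<close>

lemma polylog_combination_integrate_0:
  assumes f: "polylog_combination w f"
    and F: "\<And>z. z \<in> {0<..<1} \<Longrightarrow> (F has_real_derivative - (f z / (1 - z))) (at z)"
    and lim: "(F \<longlongrightarrow> C) (at_right 0)" and C: "C \<in> mzv_span (Suc w)"
  shows "polylog_combination (Suc w) F"
proof -
  obtain c where c: "\<And>ls j. (ls, j) \<in> index_pairs w \<Longrightarrow> c ls j \<in> mzv_span (w - sum_list ls - j)"
    "\<And>z. z \<in> {0<..<1} \<Longrightarrow> f z = (\<Sum>(ls, j)\<in>index_pairs w. c ls j * logpow j z * polylog (rev ls) z)"
    using f unfolding polylog_combination_def by force
  \<comment> \<open>The kernel 1/(1 - z) is written as a leading exponent 0 over z; integration
    raises this exponent to \<open>Suc 0\<close>.\<close>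
  define G where "G z = (\<Sum>(ls, j)\<in>index_pairs w. c ls j * prim (Suc 0) (rev ls) j z)" for z
  have G: "(G has_real_derivative f z / (1 - z)) (at z)" if z: "z \<in> {0<..<1}" for z
  proof -
    have "(G has_real_derivative (\<Sum>(ls, j)\<in>index_pairs w. c ls j * (logpow j z * (polylog (0 # rev ls) z / z)))) (at z)"
      unfolding G_def case_prod_unfold
      by (intro DERIV_sum DERIV_cmult DERIV_prim z) (auto simp: index_pairs_def)
    also have "(\<Sum>(ls, j)\<in>index_pairs w. c ls j * (logpow j z * (polylog (0 # rev ls) z / z))) =
        (\<Sum>(ls, j)\<in>index_pairs w. c ls j * logpow j z * polylog (rev ls) z / (1 - z))"
      using z by (intro sum.cong refl) (auto simp: index_pairs_def polylog_Cons_0)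
    also have "\<dots> = f z / (1 - z)"
      using z by (simp add: c(2) sum_divide_distrib case_prod_unfold)
    finally show ?thesis .
  qed
  have "\<exists>K. \<forall>z\<in>{0<..<1}. F z + G z = K"
  proof (rule has_field_derivative_zero_constant)
    fix z :: real assume z: "z \<in> {0<..<1}"
    have "((\<lambda>z. F z + G z) has_real_derivative 0) (at z)"
      using DERIV_add[OF F[OF z] G[OF z]] by simp
    then show "((\<lambda>z. F z + G z) has_real_derivative 0) (at z within {0<..<1})"
      by (rule has_field_derivative_at_within)
  qed simp
  then obtain K where K: "\<And>z. z \<in> {0<..<1} \<Longrightarrow> F z + G z = K"
    by blast
  \<comment> \<open>All primitives vanish at 0, also those that diverge at 1, so the constant of
    integration is the limit of \<open>F\<close> alone.\<close>
  have "((\<lambda>z. F z + G z) \<longlongrightarrow> C + (\<Sum>(ls, j)\<in>index_pairs w. c ls j * 0)) (at_right 0)"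
    unfolding G_def case_prod_unfold
    by (intro tendsto_intros lim prim_tendsto_0) (auto simp: index_pairs_def)
  then have "((\<lambda>z. F z + G z) \<longlongrightarrow> C) (at_right 0)"
    by simp
  moreover have "eventually (\<lambda>z. F z + G z = K) (at_right 0)"
    using K eventually_at_right_real[of 0 1] by (auto elim: eventually_mono)
  ultimately have "K = C"
    by (intro tendsto_unique[of "at_right 0" "\<lambda>z. F z + G z"]) (auto intro: tendsto_eventually)
  have "polylog_combination (Suc w) (\<lambda>z. C + (\<Sum>p\<in>index_pairs w. (- c (fst p) (snd p)) * prim 1 (rev (fst p)) (snd p) z))"
  proof (intro polylog_combination_add polylog_combination_sum finite_index_pairs)
    show "polylog_combination (Suc w) (\<lambda>z. C)"
      using polylog_combination_monom[of "[]" C "Suc w" "Suc w" 0] C by simp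
    fix p assume "p \<in> index_pairs w"
    then have p: "(fst p, snd p) \<in> index_pairs w"
      by simp
    then show "polylog_combination (Suc w) (\<lambda>z. (- c (fst p) (snd p)) * prim 1 (rev (fst p)) (snd p) z)"
      by (intro polylog_combination_prim[where v = "w - sum_list (fst p) - snd p"] mzv_span_uminus c)
        (auto simp: index_pairs_def)
  qed
  then show ?thesis
  proof (rule polylog_combination_cong)
    fix z :: real assume "z \<in> {0<..<1}"
    then have "F z = C - G z"
      using K[of z] \<open>K = C\<close> by simp
    then show "F z = C + (\<Sum>p\<in>index_pairs w. (- c (fst p) (snd p)) * prim 1 (rev (fst p)) (snd p) z)"
      by (simp add: G_def case_prod_unfold sum_negf)
  qed
qed

text \<open>Primitives for the kernel 1/z. The empty index has no leading exponent to raise; there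
  the power of the logarithm is integrated directly.\<close>

definition prim1 :: "nat list \<Rightarrow> nat \<Rightarrow> real \<Rightarrow> real" where
  "prim1 ks j z = (case ks of [] \<Rightarrow> - logpow (Suc j) z | k # ks' \<Rightarrow> prim (Suc k) ks' j z)"

definition prim1_limit :: "nat list \<Rightarrow> nat \<Rightarrow> real" where
  "prim1_limit ks j = (case ks of [] \<Rightarrow> 0 | k # ks' \<Rightarrow> mzv (rev ((Suc k + j) # ks')))"

lemma DERIV_prim1:
  assumes "is_index ks" "z \<in> {0<..<1}"
  shows "(prim1 ks j has_real_derivative logpow j z * (polylog ks z / z)) (at z)"
proof (cases ks)
  case Nil
  have "((\<lambda>z. - logpow (Suc j) z) has_real_derivative - (- logpow j z / z)) (at z)"
    using assms by (intro DERIV_minus DERIV_logpow) auto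
  then show ?thesis
    by (simp add: prim1_def[abs_def] Nil)
next
  case (Cons k ls)
  then show ?thesis
    using DERIV_prim[of ls z k j] assms by (simp add: prim1_def[abs_def])
qed

lemma prim1_tendsto:
  assumes "is_index ks"
  shows "(prim1 ks j \<longlongrightarrow> prim1_limit ks j) (at_left 1)"
proof (cases ks)
  case Nil
  then show ?thesis
    using tendsto_minus[OF logpow_tendsto_0_at_left_1[of "Suc j"]]
    by (simp add: prim1_def[abs_def] prim1_limit_def)
next
  case (Cons k ls)
  then show ?thesis
    using prim_tendsto_mzv[of ls "Suc k" j] assms by (simp add: prim1_def[abs_def] prim1_limit_def)
qed

lemma prim1_limit_in_span:
  assumes "is_index ks"
  shows "prim1_limit ks j \<in> mzv_span (Suc (sum_list ks + j))"
proof (cases ks)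
  case (Cons k ls)
  then have "admissible_rev ((Suc k + j) # ls)"
    using assms by (simp add: admissible_rev_def)
  from mzv_in_mzv_span[OF this] show ?thesis
    by (simp add: prim1_limit_def Cons add_ac)
qed (simp add: prim1_limit_def mzv_span_0)

lemma polylog_combination_prim1:
  assumes "is_index ks" "x \<in> mzv_span v" "w = Suc (v + sum_list ks + j)"
  shows "polylog_combination w (\<lambda>z. x * prim1 ks j z)"
proof (cases ks)
  case Nil
  have "polylog_combination w (\<lambda>z. (- x) * logpow (Suc j) z * polylog [] z)"
    using assms Nil by (intro polylog_combination_monom mzv_span_uminus) auto
  then show ?thesis
    by (simp add: prim1_def Nil)
next
  case (Cons k ls)
  then show ?thesis
    using polylog_combination_prim[of ls x v "Suc k" w j] assms by (simp add: prim1_def add_ac)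
qed

lemma polylog_combination_integrate_1:
  assumes f: "polylog_combination w f"
    and F: "\<And>z. z \<in> {0<..<1} \<Longrightarrow> (F has_real_derivative - (f z / z)) (at z)"
    and lim: "(F \<longlongrightarrow> 0) (at_left 1)"
  shows "polylog_combination (Suc w) F"
proof -
  obtain c where c: "\<And>ls j. (ls, j) \<in> index_pairs w \<Longrightarrow> c ls j \<in> mzv_span (w - sum_list ls - j)"
    "\<And>z. z \<in> {0<..<1} \<Longrightarrow> f z = (\<Sum>(ls, j)\<in>index_pairs w. c ls j * logpow j z * polylog (rev ls) z)"
    using f unfolding polylog_combination_def by force
  define G where "G z = (\<Sum>(ls, j)\<in>index_pairs w. c ls j * prim1 (rev ls) j z)" for z
  define C where "C = (\<Sum>(ls, j)\<in>index_pairs w. c ls j * prim1_limit (rev ls) j)"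
  have G: "(G has_real_derivative f z / z) (at z)" if z: "z \<in> {0<..<1}" for z
  proof -
    have "(G has_real_derivative (\<Sum>(ls, j)\<in>index_pairs w. c ls j * (logpow j z * (polylog (rev ls) z / z)))) (at z)"
      unfolding G_def case_prod_unfold
      by (intro DERIV_sum DERIV_cmult DERIV_prim1 z) (auto simp: index_pairs_def)
    also have "(\<Sum>(ls, j)\<in>index_pairs w. c ls j * (logpow j z * (polylog (rev ls) z / z))) = f z / z"
      using z by (simp add: c(2) sum_divide_distrib case_prod_unfold mult.assoc)
    finally show ?thesis .
  qed
  have "\<exists>K. \<forall>z\<in>{0<..<1}. F z + G z = K"
  proof (rule has_field_derivative_zero_constant)
    fix z :: real assume z: "z \<in> {0<..<1}"
    have "((\<lambda>z. F z + G z) has_real_derivative 0) (at z)"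
      using DERIV_add[OF F[OF z] G[OF z]] by simp
    then show "((\<lambda>z. F z + G z) has_real_derivative 0) (at z within {0<..<1})"
      by (rule has_field_derivative_at_within)
  qed simp
  then obtain K where K: "\<And>z. z \<in> {0<..<1} \<Longrightarrow> F z + G z = K"
    by blast
  \<comment> \<open>Every leading exponent has been raised to at least 2 and the bare logarithms
    vanish at 1, so each term has a finite limit.\<close>
  have "((\<lambda>z. F z + G z) \<longlongrightarrow> 0 + C) (at_left 1)"
    unfolding G_def C_def case_prod_unfold
    by (intro tendsto_intros lim prim1_tendsto) (auto simp: index_pairs_def)
  moreover have "eventually (\<lambda>z. F z + G z = K) (at_left 1)"
    using K eventually_at_left_real[of 0 1] by (auto elim: eventually_mono)
  ultimately have "K = 0 + C"
    by (intro tendsto_unique[of "at_left 1" "\<lambda>z. F z + G z"]) (auto intro: tendsto_eventually)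
  \<comment> \<open>Old coefficients meet new zeta values here; this is the one place where products
    of multiple zeta values arise.\<close>
  have "C \<in> mzv_span (Suc w)"
    unfolding C_def case_prod_unfold
  proof (rule mzv_span_sum)
    fix p assume "p \<in> index_pairs w"
    then have p: "(fst p, snd p) \<in> index_pairs w"
      by simp
    then have "is_index (rev (fst p))" "w - sum_list (fst p) - snd p + Suc (sum_list (rev (fst p)) + snd p) = Suc w"
      by (auto simp: index_pairs_def)
    then show "c (fst p) (snd p) * prim1_limit (rev (fst p)) (snd p) \<in> mzv_span (Suc w)"
      using mzv_span_mult[OF c(1)[OF p] prim1_limit_in_span[of "rev (fst p)" "snd p"]] by metis
  qed
  have "polylog_combination (Suc w) (\<lambda>z. C + (\<Sum>p\<in>index_pairs w. (- c (fst p) (snd p)) * prim1 (rev (fst p)) (snd p) z))"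
  proof (intro polylog_combination_add polylog_combination_sum finite_index_pairs)
    show "polylog_combination (Suc w) (\<lambda>z. C)"
      using polylog_combination_monom[of "[]" C "Suc w" "Suc w" 0] \<open>C \<in> mzv_span (Suc w)\<close> by simp
    fix p assume "p \<in> index_pairs w"
    then have p: "(fst p, snd p) \<in> index_pairs w"
      by simp
    then show "polylog_combination (Suc w) (\<lambda>z. (- c (fst p) (snd p)) * prim1 (rev (fst p)) (snd p) z)"
      by (intro polylog_combination_prim1[where v = "w - sum_list (fst p) - snd p"] mzv_span_uminus c)
        (auto simp: index_pairs_def)
  qed
  then show ?thesis
  proof (rule polylog_combination_cong)
    fix z :: real assume "z \<in> {0<..<1}"
    then have "F z = C - G z"
      using K[of z] \<open>K = 0 + C\<close> by simp
    then show "F z = C + (\<Sum>p\<in>index_pairs w. (- c (fst p) (snd p)) * prim1 (rev (fst p)) (snd p) z)"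
      by (simp add: G_def case_prod_unfold sum_negf)
  qed
qed

text \<open>An inner induction runs over the leading exponent. Lowering an exponent of at least 2
  leaves the kernel 1/(1 - z), and the limit at z = 0 is an admissible zeta value. Removing an
  exponent 1 leaves the kernel 1/z; the function then diverges at z = 0 but vanishes at z =
  1.\<close>

theorem connection_formula:
  assumes "is_index ks"
  shows "polylog_combination (sum_list ks) (\<lambda>z. polylog ks (1 - z))"
  using assms
proof (induction ks)
  case Nil
  then show ?case
    using polylog_combination_monom[of "[]" 1 0 0 0] by (simp add: mzv_span_1)
next
  case (Cons k ks)
  then have ks: "is_index ks" and k: "k \<ge> 1" and IH: "polylog_combination (sum_list ks) (\<lambda>z. polylog ks (1 - z))"
    by auto
  have deriv: "((\<lambda>z. polylog (Suc k # ks) (1 - z)) has_real_derivative - (polylog (k # ks) (1 - z) / (1 - z))) (at z)"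
    if "z \<in> {0<..<1}" for z k
  proof -
    have "((\<lambda>z. polylog (Suc k # ks) (1 - z)) has_real_derivative polylog (k # ks) (1 - z) / (1 - z) * (- 1)) (at z)"
      using that by (intro DERIV_chain'[where f = "\<lambda>z. 1 - z"] DERIV_polylog ks)
        (auto intro!: derivative_eq_intros)
    then show ?thesis
      by simp
  qed
  show ?case
    using k
  proof (induction k rule: dec_induct)
    case base
    have "polylog_combination (Suc (sum_list ks)) (\<lambda>z. polylog (Suc 0 # ks) (1 - z))"
    proof (rule polylog_combination_integrate_1[OF IH])
      fix z :: real assume z: "z \<in> {0<..<1}"
      have "polylog (0 # ks) (1 - z) / (1 - z) = polylog ks (1 - z) / z"
        using z by (simp add: polylog_Cons_0 ks)
      with deriv[OF z, of 0]
      show "((\<lambda>z. polylog (Suc 0 # ks) (1 - z)) has_real_derivative - (polylog ks (1 - z) / z)) (at z)"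
        by simp
    next
      have "isCont (\<lambda>z. polylog (Suc 0 # ks) (1 - z)) 1"
        by (rule isCont_o2[where f = "\<lambda>z. 1 - z"]) (auto intro!: isCont_polylog continuous_intros ks)
      then have "((\<lambda>z. polylog (Suc 0 # ks) (1 - z)) \<longlongrightarrow> 0) (at 1)"
        by (simp add: isCont_def)
      then show "((\<lambda>z. polylog (Suc 0 # ks) (1 - z)) \<longlongrightarrow> 0) (at_left 1)"
        by (rule tendsto_within_subset) simp
    qed
    then show ?case
      by simp
  next
    case (step k)
    have "polylog_combination (Suc (sum_list (k # ks))) (\<lambda>z. polylog (Suc k # ks) (1 - z))"
    proof (rule polylog_combination_integrate_0[OF step.IH deriv])
      have "filterlim (\<lambda>z::real. 1 - z) (at_left 1) (at_right 0)"
        by (intro filterlim_at_withinI) 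
          (auto intro!: tendsto_eq_intros simp: eventually_at_right_less)
      then show "((\<lambda>z. polylog (Suc k # ks) (1 - z)) \<longlongrightarrow> mzv (rev (Suc k # ks))) (at_right 0)"
        using step ks by (intro filterlim_compose[OF polylog_tendsto_mzv]) auto
      show "mzv (rev (Suc k # ks)) \<in> mzv_span (Suc (sum_list (k # ks)))"
        using mzv_in_mzv_span[of "Suc k # ks"] step ks by (simp add: admissible_rev_def)
    qed
    then show ?case
      by simp
  qed
qed

subsection \<open>Continuation from half-planes\<close>

lemma open_halfplane_Re_gt_real [simp]: "open {s. Re s > c}"
  by (rule open_halfspace_Re_gt)

lemma connected_halfplane_Re_gt [simp]: "connected {s. Re s > c}"
  by (intro convex_connected convex_halfspace_Re_gt)

lemma nicely_meromorphic_on_cong: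
  assumes "f nicely_meromorphic_on S" "open S" "\<And>z. z \<in> S \<Longrightarrow> f z = g z"
  shows "g nicely_meromorphic_on S"
proof -
  have ev: "eventually (\<lambda>w. f w = g w) (at z)" if "z \<in> S" for z
    using eventually_at_in_open'[OF \<open>open S\<close> that] by eventually_elim (use assms(3) in auto)
  have "g meromorphic_on S"
    using assms(1) meromorphic_on_cong[of S f g S, OF ev refl] unfolding nicely_meromorphic_on_def by blast
  moreover have "(is_pole g z \<and> g z = 0) \<or> g \<midarrow>z\<rightarrow> g z" if z: "z \<in> S" for z
  proof -
    have "(is_pole f z \<and> f z = 0) \<or> f \<midarrow>z\<rightarrow> f z"
      using assms(1) z by (auto simp: nicely_meromorphic_on_def)
    then show ?thesis
      using is_pole_cong[OF ev[OF z] refl] tendsto_cong[OF ev[OF z]] assms(3)[OF z] by auto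
  qed
  ultimately show ?thesis
    by (auto simp: nicely_meromorphic_on_def)
qed

lemma nicely_meromorphic_on_pointwise:
  assumes "\<And>z. z \<in> S \<Longrightarrow> \<exists>T. z \<in> T \<and> f nicely_meromorphic_on T"
  shows "f nicely_meromorphic_on S"
  unfolding nicely_meromorphic_on_def
proof (intro conjI ballI)
  show "f meromorphic_on S"
    using assms unfolding nicely_meromorphic_on_def meromorphic_on_def by blast
qed (use assms in \<open>unfold nicely_meromorphic_on_def, blast\<close>)

text \<open>A meromorphic function on a connected open set is either zero off a sparse set or
  nonzero off a sparse set; the open set \<open>U\<close> excludes the second case for the
  difference.\<close>

lemma meromorphic_eq_cosparse:
  assumes "f meromorphic_on S" "g meromorphic_on S" "open S" "connected S"
    and U: "open U" "U \<subseteq> S" "U \<noteq> {}" "\<And>z. z \<in> U \<Longrightarrow> f z = g z"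
  shows "\<forall>\<^sub>\<approx>z\<in>S. f z = g z"
proof -
  obtain z where z: "z \<in> U"
    using U by blast
  have "(\<lambda>z. f z - g z) meromorphic_on S"
    using assms by (intro meromorphic_intros)
  then have "(\<forall>\<^sub>\<approx>z\<in>S. f z - g z = 0) \<or> (\<forall>\<^sub>\<approx>z\<in>S. f z - g z \<noteq> 0)"
    using assms by (intro meromorphic_imp_constant_or_avoid)
  moreover have False if "\<forall>\<^sub>\<approx>z\<in>S. f z - g z \<noteq> 0"
  proof -
    have "eventually (\<lambda>w. f w - g w \<noteq> 0) (at z)"
      using that z U assms by (auto simp: eventually_cosparse_open_eq)
    then have "eventually (\<lambda>_. False) (at z)"
      using eventually_at_in_open'[OF \<open>open U\<close> z] by eventually_elim (use U in auto)
    then show False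
      by simp
  qed
  ultimately show ?thesis
    by auto
qed

text \<open>Off a sparse set the functions agree by the identity theorem. A nicely meromorphic
  function is determined at a point by its values nearby (0 at a pole, the limit otherwise), so they
  agree everywhere. This justifies the definite descriptions of \<open>mzeta\<close> and
  \<open>xi\<close>.\<close>

lemma nicely_meromorphic_eqI:
  assumes "f nicely_meromorphic_on S" "g nicely_meromorphic_on S" "open S" "connected S"
    and U: "open U" "U \<subseteq> S" "U \<noteq> {}" "\<And>z. z \<in> U \<Longrightarrow> f z = g z"
    and z: "z \<in> S"
  shows "f z = g z"
proof -
  have "\<forall>\<^sub>\<approx>z\<in>S. f z = g z"
    by (rule meromorphic_eq_cosparse[of _ _ _ U]) (use assms in \<open>auto simp: nicely_meromorphic_on_def\<close>)
  then have ev: "eventually (\<lambda>w. f w = g w) (at z)"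
    using z assms by (auto simp: eventually_cosparse_open_eq)
  have f: "(is_pole f z \<and> f z = 0) \<or> f \<midarrow>z\<rightarrow> f z" and g: "(is_pole g z \<and> g z = 0) \<or> g \<midarrow>z\<rightarrow> g z"
    using assms by (auto simp: nicely_meromorphic_on_def)
  have pole: "is_pole f z \<longleftrightarrow> is_pole g z"
    by (rule is_pole_cong) (use ev in auto)
  show ?thesis
  proof (cases "is_pole f z")
    case True
    then have "\<not> f \<midarrow>z\<rightarrow> f z" "\<not> g \<midarrow>z\<rightarrow> g z"
      using pole not_tendsto_and_filterlim_at_infinity[of "at z"] unfolding is_pole_def by auto
    then show ?thesis
      using f g by simp
  next
    case False
    then have "f \<midarrow>z\<rightarrow> f z" "f \<midarrow>z\<rightarrow> g z"
      using f g pole tendsto_cong[OF ev] by auto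
    then show ?thesis
      by (rule LIM_unique)
  qed
qed

text \<open>Any two pieces agree far to the right, where both equal \<open>g\<close>, hence on the
  whole smaller half-plane by the identity theorem.\<close>

lemma nicely_meromorphic_glue:
  fixes F :: "nat \<Rightarrow> complex \<Rightarrow> complex" and a c :: real
  assumes F: "\<And>n. F n nicely_meromorphic_on {s. Re s > a - real n}"
    and eq: "\<And>n s. Re s > c \<Longrightarrow> F n s = g s"
  shows "\<exists>f. f nicely_meromorphic_on UNIV \<and> (\<forall>s. Re s > c \<longrightarrow> f s = g s) \<and>
    (\<forall>n s. Re s > a - real n \<longrightarrow> f s = F n s)"
proof -
  \<comment> \<open>An index whose half-plane contains \<open>s\<close>; the added 1 makes the
    inequality strict.\<close>
  define N where "N s = nat \<lceil>a - Re s\<rceil> + 1" for s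
  have N: "Re s > a - real (N s)" for s
    unfolding N_def by linarith
  have agree: "F m s = F n s" if "Re s > a - real m" "Re s > a - real n" for m n s
  proof (rule nicely_meromorphic_eqI[where f = "F m" and g = "F n" and S = "{s. Re s > max (a - real m) (a - real n)}" and
        U = "{s. Re s > max c (max (a - real m) (a - real n))}"])
    show "F m nicely_meromorphic_on {s. Re s > max (a - real m) (a - real n)}"
      by (rule nicely_meromorphic_on_subset[OF F]) auto
    show "F n nicely_meromorphic_on {s. Re s > max (a - real m) (a - real n)}"
      by (rule nicely_meromorphic_on_subset[OF F]) auto
    show "{s. Re s > max c (max (a - real m) (a - real n))} \<noteq> {}"
      by (metis (mono_tags) Re_complex_of_real empty_iff gt_ex mem_Collect_eq)
    show "F m z = F n z" if "z \<in> {s. Re s > max c (max (a - real m) (a - real n))}" for z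
      using that eq by simp
    show "open {s. Re s > max (a - real m) (a - real n)}" "connected {s. Re s > max (a - real m) (a - real n)}"
      "open {s. Re s > max c (max (a - real m) (a - real n))}"
      by (simp_all only: open_halfplane_Re_gt_real connected_halfplane_Re_gt)
    show "{s. Re s > max c (max (a - real m) (a - real n))} \<subseteq> {s. Re s > max (a - real m) (a - real n)}"
      by auto
    show "s \<in> {s. Re s > max (a - real m) (a - real n)}"
      using that by simp
  qed
  define f where "f s = F (N s) s" for s
  have f: "f s = F n s" if "Re s > a - real n" for n s
    unfolding f_def by (rule agree) (use N that in auto)
  show ?thesis
  proof (intro exI[of _ f] conjI allI impI)
    show "f s = F n s" if "Re s > a - real n" for n s
      by (rule f) fact
    show "f s = g s" if "Re s > c" for s
      unfolding f_def by (rule eq) fact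
    have nice: "f nicely_meromorphic_on {s. Re s > a - real n}" for n
      by (rule nicely_meromorphic_on_cong[OF F[of n]]) (use f in auto)
    show "f nicely_meromorphic_on UNIV"
    proof (rule nicely_meromorphic_on_pointwise)
      fix z
      show "\<exists>T. z \<in> T \<and> f nicely_meromorphic_on T"
        using N[of z] nice[of "N z"] by (intro exI[of _ "{s. Re s > a - real (N z)}"]) simp
    qed
  qed
qed

lemma holomorphic_on_suminf:
  fixes f :: "nat \<Rightarrow> complex \<Rightarrow> complex"
  assumes "open S" "\<And>n. f n holomorphic_on S"
    and "\<And>x. x \<in> S \<Longrightarrow> \<exists>d h. 0 < d \<and> summable h \<and> (\<forall>n. \<forall>y\<in>ball x d \<inter> S. norm (f n y) \<le> h n)"
  shows "(\<lambda>x. \<Sum>n. f n x) holomorphic_on S"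
proof -
  obtain g where g: "\<forall>x\<in>S. ((\<lambda>n. f n x) sums g x) \<and> g field_differentiable (at x)"
  proof (rule series_differentiable_comparison_complex[OF \<open>open S\<close>])
    show "f n field_differentiable at x" if "x \<in> S" for n x
      using assms(1,2) that holomorphic_on_imp_differentiable_at by blast
    fix x assume x: "x \<in> S"
    then obtain d h where dh: "0 < d" "summable h" "\<And>n y. y \<in> ball x d \<inter> S \<Longrightarrow> norm (f n y) \<le> h n"
      using assms(3) by meson
    have h: "h n \<ge> 0" for n
      using dh(3)[of x n] dh(1) x norm_ge_zero order_trans by (metis IntI centre_in_ball)
    show "\<exists>d h. 0 < d \<and> summable h \<and> range h \<subseteq> \<real>\<^sub>\<ge>\<^sub>0 \<and>
        (\<forall>\<^sub>F n in sequentially. \<forall>y\<in>ball x d \<inter> S. cmod (f n y) \<le> cmod (h n))"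
    proof (intro exI conjI)
      show "summable (\<lambda>n. complex_of_real (h n))"
        using dh(2) by (rule summable_of_real)
      show "range (\<lambda>n. complex_of_real (h n)) \<subseteq> \<real>\<^sub>\<ge>\<^sub>0"
        using h by auto
      show "\<forall>\<^sub>F n in sequentially. \<forall>y\<in>ball x d \<inter> S. cmod (f n y) \<le> cmod (complex_of_real (h n))"
        using dh(3) h by (intro always_eventually) auto
    qed (rule dh(1))
  qed
  have "g holomorphic_on S"
    using g \<open>open S\<close> by (auto simp: holomorphic_on_open field_differentiable_def)
  moreover have "g x = (\<Sum>n. f n x)" if "x \<in> S" for x
    using g that by (auto simp: sums_iff)
  ultimately show ?thesis
    by (rule holomorphic_transform)
qed

subsection \<open>The Dirichlet series with multiple harmonic sums as coefficients\<close>

text \<open>The exponents \<open>ks\<close> belong to the inner variables only; the outermost one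
  carries \<open>s\<close>. The empty index gives the Riemann zeta series.\<close>

definition mzeta_dirichlet :: "nat list \<Rightarrow> complex \<Rightarrow> complex" where
  "mzeta_dirichlet ks s = (\<Sum>n. of_real (hsum ks (Suc n)) * of_nat (Suc n) powr (-s))"

lemma norm_of_nat_powr: "norm (of_nat n powr s :: complex) = real n powr Re s"
  by (subst norm_powr_real_powr) auto

lemma mzeta_dirichlet_summable_norm:
  assumes "is_index ks" "Re s > 1"
  shows "summable (\<lambda>n. norm (of_real (hsum ks (Suc n)) * of_nat (Suc n) powr (-s) :: complex))"
  using summable_hsum_powr[OF assms] by (simp add: norm_mult norm_of_nat_powr hsum_nonneg del: of_nat_Suc)

lemma mzeta_dirichlet_sums:
  assumes "is_index ks" "Re s > 1"
  shows "(\<lambda>n. of_real (hsum ks (Suc n)) * of_nat (Suc n) powr (-s)) sums mzeta_dirichlet ks s"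
  unfolding mzeta_dirichlet_def
  by (rule summable_sums[OF summable_norm_cancel[OF mzeta_dirichlet_summable_norm[OF assms]]])

lemma mzeta_series_eq:
  assumes "is_index ls" "Re s > 1"
  shows "mzeta_series ls s = mzeta_dirichlet (rev ls) s"
proof -
  have "mzeta_series ls s = (\<Sum>\<^sub>\<infinity>ms\<in>incr_tuples (Suc (length ls)).
      of_nat (last ms) powr (-s) / of_nat (tuple_weight ls ms))"
    unfolding mzeta_series_def
  proof (rule infsum_cong)
    fix ms assume "ms \<in> incr_tuples (Suc (length ls))"
    then have "ms \<noteq> []" "length ms = Suc (length ls)"
      by (auto simp: incr_tuples_def)
    then have "ms ! length ls = last ms"
      by (simp add: last_conv_nth)
    then show "1 / ((\<Prod>i<length ls. of_nat (ms ! i) ^ (ls ! i)) * of_nat (ms ! length ls) powr s) =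
        of_nat (last ms) powr (-s) / of_nat (tuple_weight ls ms)"
      by (simp add: powr_minus field_simps)
  qed
  also have "\<dots> = mzeta_dirichlet (rev ls) s"
    unfolding mzeta_dirichlet_def
    by (rule infsum_incr_tuples_Suc)
      (use summable_hsum_powr[of "rev ls" "Re s"] assms in \<open>simp add: norm_of_nat_powr del: of_nat_Suc\<close>)
  finally show ?thesis .
qed

lemma mzeta_dirichlet_holomorphic:
  assumes "is_index ks"
  shows "mzeta_dirichlet ks holomorphic_on {s. Re s > 1}"
  unfolding mzeta_dirichlet_def
proof (rule holomorphic_on_suminf)
  show "(\<lambda>s. of_real (hsum ks (Suc n)) * of_nat (Suc n) powr (-s)) holomorphic_on {s. Re s > 1}" for n
    by (intro holomorphic_intros)
  fix x assume x: "x \<in> {s. Re s > 1}"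
  define a where "a = (Re x + 1) / 2"
  have a: "a > 1" "a < Re x"
    using x by (auto simp: a_def)
  show "\<exists>d h. 0 < d \<and> summable h \<and> (\<forall>n. \<forall>y\<in>ball x d \<inter> {s. Re s > 1}.
      norm (of_real (hsum ks (Suc n)) * of_nat (Suc n) powr (-y) :: complex) \<le> h n)"
  proof (intro exI conjI allI ballI)
    show "0 < Re x - a"
      using a by simp
    show "summable (\<lambda>n. hsum ks (Suc n) * real (Suc n) powr (-a))"
      by (rule summable_hsum_powr) fact+
    fix n y assume "y \<in> ball x (Re x - a) \<inter> {s. Re s > 1}"
    then have "Re y \<ge> a"
      using abs_Re_le_cmod[of "x - y"] by (auto simp: dist_norm)
    then have "real (Suc n) powr (- Re y) \<le> real (Suc n) powr (- a)"
      by (intro powr_mono) auto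
    then show "norm (of_real (hsum ks (Suc n)) * of_nat (Suc n) powr (-y) :: complex) \<le>
        hsum ks (Suc n) * real (Suc n) powr (-a)"
      by (simp add: norm_mult norm_of_nat_powr hsum_nonneg mult_left_mono del: of_nat_Suc)
  qed
qed auto

text \<open>The Taylor expansion of \<open>x powr (1 - s)\<close> about \<open>x = n + 1\<close>, evaluated at \<open>x = n\<close>.\<close>

lemma powr_difference_expansion:
  fixes s :: complex
  assumes n: "n \<ge> 1" and K: "Re s + real K \<ge> 0"
  shows "norm (of_nat n powr (1 - s) - (\<Sum>i\<le>K. pochhammer (s - 1) i / fact i * of_nat (Suc n) powr (1 - s - of_nat i)))
    \<le> norm (pochhammer (s - 1) (Suc K)) / fact K * real n powr (- (Re s + real K))"
proof -
  define S where "S = complex_of_real ` {real n..real (Suc n)}"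
  \<comment> \<open>The i-th derivative of \<open>x powr (1 - s)\<close>: its falling product is the
    Pochhammer symbol of s - 1 up to the sign, and the sign cancels against the Taylor step
    -1.\<close>
  define f where "f i x = (- 1) ^ i * pochhammer (s - 1) i * x powr (1 - s - of_nat i)" for i and x :: complex
  have conv: "convex S"
    unfolding S_def by (intro convex_linear_image) auto
  have pos: "Re x \<ge> real n" "Re x > 0" "x \<notin> \<real>\<^sub>\<le>\<^sub>0" "x \<in> \<real>" if "x \<in> S" for x
    using that n by (auto simp: S_def complex_nonpos_Reals_iff)
  have T: "norm (f 0 (of_nat n) - (\<Sum>i\<le>K. f i (of_nat (Suc n)) * (of_nat n - of_nat (Suc n)) ^ i / fact i))
      \<le> (norm (pochhammer (s - 1) (Suc K)) * real n powr (- (Re s + real K))) * norm (of_nat n - of_nat (Suc n) :: complex) ^ Suc K / fact K"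
  proof (rule complex_Taylor[OF conv])
    fix i x assume x: "x \<in> S"
    have "((\<lambda>x. (- 1) ^ i * pochhammer (s - 1) i * x powr (1 - s - of_nat i)) has_field_derivative
        (- 1) ^ i * pochhammer (s - 1) i * ((1 - s - of_nat i) * x powr (1 - s - of_nat i - 1))) (at x)"
      using pos[OF x] by (intro DERIV_cmult has_field_derivative_powr) auto
    moreover have "(- 1) ^ i * pochhammer (s - 1) i * ((1 - s - of_nat i) * x powr (1 - s - of_nat i - 1)) = f (Suc i) x"
      by (simp add: f_def pochhammer_Suc algebra_simps)
    ultimately show "(f i has_field_derivative f (Suc i) x) (at x within S)"
      unfolding f_def by (metis has_field_derivative_at_within)
  next
    fix x assume x: "x \<in> S"
    have "norm (x powr (1 - s - of_nat (Suc K))) = Re x powr (- (Re s + real K))"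
      using pos[OF x] by (subst norm_powr_real_powr) (auto simp: algebra_simps)
    \<comment> \<open>By the hypothesis on \<open>K\<close> the exponent is not positive, so on the
      segment the power is largest at the left end.\<close>
    also have "\<dots> \<le> real n powr (- (Re s + real K))"
      using pos[OF x] n K by (intro powr_mono2') auto
    finally show "norm (f (Suc K) x) \<le> norm (pochhammer (s - 1) (Suc K)) * real n powr (- (Re s + real K))"
      by (simp add: f_def norm_mult norm_power mult_left_mono del: of_nat_Suc pochhammer_Suc)
  next
    show "complex_of_nat (Suc n) \<in> S"
      unfolding S_def by (rule image_eqI[of _ _ "real (Suc n)"]) auto
    show "complex_of_nat n \<in> S"
      unfolding S_def by (rule image_eqI[of _ _ "real n"]) auto
  qed
  have eq: "f i (of_nat (Suc n)) * (of_nat n - of_nat (Suc n)) ^ i / fact i =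
      pochhammer (s - 1) i / fact i * of_nat (Suc n) powr (1 - s - of_nat i)" for i
  proof -
    have "(- 1) ^ i * (- 1) ^ i = (1 :: complex)"
      by (simp flip: power_mult_distrib)
    moreover have "of_nat n - of_nat (Suc n) = (- 1 :: complex)"
      by simp
    ultimately show ?thesis
      unfolding f_def by (simp add: mult_ac del: of_nat_Suc)
  qed
  show ?thesis
    using T unfolding eq by (simp add: f_def del: pochhammer_Suc)
qed

section \<open>The translation equation and its remainder\<close>

definition powr_remainder :: "nat \<Rightarrow> nat \<Rightarrow> complex \<Rightarrow> complex" where
  "powr_remainder K n s = of_nat n powr (1 - s) -
     (\<Sum>i\<le>K. pochhammer (s - 1) i / fact i * of_nat (Suc n) powr (1 - s - of_nat i))"

text \<open>\<open>hsum\<close> is taken at the larger end of each interval, so that the expanded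
  powers form the Dirichlet series itself and only the power at \<open>Suc n\<close> calls for
  summation by parts.\<close>

definition mzeta_remainder :: "nat \<Rightarrow> nat list \<Rightarrow> complex \<Rightarrow> complex" where
  "mzeta_remainder K ks s = (\<Sum>n. of_real (hsum ks (Suc (Suc n))) * powr_remainder K (Suc n) s)"

lemma holomorphic_on_pochhammer [holomorphic_intros]:
  "f holomorphic_on S \<Longrightarrow> (\<lambda>s. pochhammer (f s) n) holomorphic_on S"
  unfolding pochhammer_prod by (intro holomorphic_intros)

text \<open>The expansion error is of order n^(-Re s - K), locally uniformly in s, and the
  coefficients grow slower than any power. Each further term of the expansion therefore gains a
  strip of width 1.\<close>

lemma mzeta_remainder_holomorphic:
  assumes "is_index ks"
  shows "mzeta_remainder K ks holomorphic_on {s. Re s > 1 - real K}"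
  unfolding mzeta_remainder_def
proof (rule holomorphic_on_suminf)
  show "(\<lambda>s. of_real (hsum ks (Suc (Suc n))) * powr_remainder K (Suc n) s) holomorphic_on {s. Re s > 1 - real K}" for n
    unfolding powr_remainder_def by (intro holomorphic_intros) auto
  fix x assume x: "x \<in> {s. Re s > 1 - real K}"
  \<comment> \<open>Half the distance to the boundary line: on the ball of radius \<open>d\<close>
    the exponent Re y + K is still at least 1 + d.\<close>
  define d where "d = (Re x + real K - 1) / 2"
  have d: "d > 0" "Re x + real K - d = 1 + d"
    using x by (auto simp: d_def field_simps)
  have "bounded ((\<lambda>y. pochhammer (y - 1) (Suc K)) ` cball x d)"
    by (intro compact_imp_bounded compact_continuous_image holomorphic_on_imp_continuous_on holomorphic_intros compact_cball)
  then obtain M where M: "\<And>y. y \<in> cball x d \<Longrightarrow> norm (pochhammer (y - 1) (Suc K)) \<le> M"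
    unfolding bounded_iff by blast
  have "M \<ge> 0"
    using M[of x] d by (meson centre_in_cball less_imp_le norm_ge_zero order_trans)
  \<comment> \<open>The factor \<open>2 powr (1 + d)\<close> pays for replacing n + 1 by n + 2,
    which is at most 2 (n + 1).\<close>
  let ?h = "\<lambda>n. M / fact K * 2 powr (1 + d) * (hsum ks (Suc (Suc n)) * real (Suc (Suc n)) powr (- (1 + d)))"
  show "\<exists>d h. 0 < d \<and> summable h \<and> (\<forall>n. \<forall>y\<in>ball x d \<inter> {s. Re s > 1 - real K}.
      norm (of_real (hsum ks (Suc (Suc n))) * powr_remainder K (Suc n) y) \<le> h n)"
  proof (rule exI[of _ d], rule exI[of _ ?h], intro conjI allI ballI)
    have "summable (\<lambda>n. hsum ks (Suc (Suc n)) * real (Suc (Suc n)) powr (- (1 + d)))"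
      using summable_hsum_powr[OF assms, of "1 + d"] d(1)
      by (subst summable_Suc_iff[of "\<lambda>n. hsum ks (Suc n) * real (Suc n) powr (- (1 + d))"]) simp
    then show "summable ?h"
      by (rule summable_mult)
    fix n y assume y: "y \<in> ball x d \<inter> {s. Re s > 1 - real K}"
    have "\<bar>Re x - Re y\<bar> < d"
      using y abs_Re_le_cmod[of "x - y"] by (auto simp: dist_norm)
    then have Re: "Re y + real K \<ge> 1 + d"
      using d(2) by linarith
    have "norm (powr_remainder K (Suc n) y) \<le>
        norm (pochhammer (y - 1) (Suc K)) / fact K * real (Suc n) powr (- (Re y + real K))"
      unfolding powr_remainder_def using Re d by (intro powr_difference_expansion) auto
    also have "\<dots> \<le> M / fact K * (2 powr (1 + d) * real (Suc (Suc n)) powr (- (1 + d)))"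
    proof (intro mult_mono divide_right_mono M)
      have "real (Suc n) powr (- (Re y + real K)) \<le> real (Suc n) powr (- (1 + d))"
        using Re by (intro powr_mono) auto
      also have "\<dots> \<le> (real (Suc (Suc n)) / 2) powr (- (1 + d))"
        using d by (intro powr_mono2') auto
      also have "(real (Suc (Suc n)) / 2) powr (- (1 + d)) = 2 powr (1 + d) * real (Suc (Suc n)) powr (- (1 + d))"
      proof -
        have "(x / 2) powr (- e) = 2 powr e * x powr (- e)" if "x > 0" for x e :: real
          using that by (simp add: powr_divide powr_minus divide_simps)
        from this[of "real (Suc (Suc n))" "1 + d"] show ?thesis
          by (simp only: of_nat_0_less_iff zero_less_Suc)
      qed
      finally show "real (Suc n) powr (- (Re y + real K)) \<le> 2 powr (1 + d) * real (Suc (Suc n)) powr (- (1 + d))" .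
    qed (use y \<open>M \<ge> 0\<close> in auto)
    finally have "hsum ks (Suc (Suc n)) * norm (powr_remainder K (Suc n) y) \<le>
        hsum ks (Suc (Suc n)) * (M / fact K * (2 powr (1 + d) * real (Suc (Suc n)) powr (- (1 + d))))"
      by (rule mult_left_mono) (rule hsum_nonneg)
    also have "\<dots> = ?h n"
      by (simp only: mult_ac)
    finally show "norm (of_real (hsum ks (Suc (Suc n))) * powr_remainder K (Suc n) y) \<le> ?h n"
      by (simp only: norm_mult norm_of_real abs_of_nonneg[OF hsum_nonneg])
  qed (rule d(1))
qed auto

text \<open>What summation by parts leaves over: the increments of \<open>hsum\<close> are the sums
  for the shorter index over a power. For the empty index there are no increments, and the 1
  compensates for the subtracted \<open>hsum [] 1\<close>.\<close>

definition mzeta_shifted_tail :: "nat list \<Rightarrow> (nat list \<Rightarrow> complex \<Rightarrow> complex) \<Rightarrow> complex \<Rightarrow> complex" where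
  "mzeta_shifted_tail ks Z s = (case ks of [] \<Rightarrow> 1 | k # ks' \<Rightarrow> Z ks' (s - 1 + of_nat k))"

text \<open>
  Summing the expansion of \<open>(m - 1) powr (1 - s) - m powr (1 - s)\<close> over \<open>m\<close>, with summation
  by parts on the left, relates the values at \<open>s\<close>, \<open>s + 1\<close>, \<dots> to the index with its last entry removed.
\<close>

lemma mzeta_translation:
  assumes ks: "is_index ks" and s: "Re s > 2" and K: "K \<ge> 1"
  shows "(s - 1) * (mzeta_dirichlet ks s - of_real (hsum ks 1)) =
    mzeta_shifted_tail ks mzeta_dirichlet s - mzeta_remainder K ks s -
    (\<Sum>i=2..K. pochhammer (s - 1) i / fact i * (mzeta_dirichlet ks (s - 1 + of_nat i) - of_real (hsum ks 1)))"
proof -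
  let ?D = "mzeta_dirichlet ks" and ?a = "of_real (hsum ks 1) :: complex"
  define V where "V = mzeta_shifted_tail ks mzeta_dirichlet s"
  have D: "(\<lambda>n. of_real (hsum ks (Suc (Suc n))) * of_nat (Suc (Suc n)) powr (1 - s - of_nat i)) sums (?D (s - 1 + of_nat i) - ?a)" for i
  proof -
    have "(\<lambda>n. of_real (hsum ks (Suc n)) * of_nat (Suc n) powr (-(s - 1 + of_nat i))) sums ?D (s - 1 + of_nat i)"
      using s by (intro mzeta_dirichlet_sums ks) auto
    then have "(\<lambda>n. of_real (hsum ks (Suc (Suc n))) * of_nat (Suc (Suc n)) powr (-(s - 1 + of_nat i))) sums
        (?D (s - 1 + of_nat i) - of_real (hsum ks (Suc 0)) * of_nat (Suc 0) powr (-(s - 1 + of_nat i)))"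
      by (subst sums_Suc_iff[of "\<lambda>n. of_real (hsum ks (Suc n)) * of_nat (Suc n) powr (-(s - 1 + of_nat i))"]) simp
    moreover have "-(s - 1 + of_nat i) = 1 - s - of_nat i" "of_nat (Suc 0) powr z = (1 :: complex)" for z
      by simp_all
    ultimately show ?thesis
      by (simp del: of_nat_Suc)
  qed
  have parts: "(\<lambda>n. of_real (hsum ks (Suc (Suc n))) * of_nat (Suc n) powr (1 - s)) sums (?D (s - 1) + V - ?a)"
  proof -
    have 1: "(\<lambda>n. of_real (hsum ks (Suc n)) * of_nat (Suc n) powr (1 - s)) sums ?D (s - 1)"
      using mzeta_dirichlet_sums[OF ks, of "s - 1"] s by simp
    show ?thesis
    proof (cases ks)
      case Nil
      then show ?thesis
        using 1 by (simp add: V_def mzeta_shifted_tail_def)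
    next
      case (Cons k ls)
      have "(\<lambda>n. of_real (hsum ls (Suc n)) * of_nat (Suc n) powr (-(s - 1 + of_nat k))) sums mzeta_dirichlet ls (s - 1 + of_nat k)"
        using s ks Cons by (intro mzeta_dirichlet_sums) auto
      moreover have "of_nat (Suc n) powr (-(s - 1 + of_nat k)) = of_nat (Suc n) powr (1 - s) / (of_nat (Suc n) ^ k :: complex)" for n
      proof -
        have "-(s - 1 + of_nat k) = (1 - s) - of_nat k"
          by simp
        then show ?thesis
          by (simp only: powr_diff) (simp add: powr_nat' del: of_nat_Suc)
      qed
      ultimately have "(\<lambda>n. of_real (hsum ls (Suc n)) * (of_nat (Suc n) powr (1 - s) / of_nat (Suc n) ^ k)) sums V"
        by (simp add: V_def mzeta_shifted_tail_def Cons del: of_nat_Suc)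
      from sums_add[OF 1 this] show ?thesis
        using Cons by (simp add: hsum_Cons_Suc algebra_simps add_divide_distrib del: of_nat_Suc)
    qed
  qed
  have "(\<lambda>n. of_real (hsum ks (Suc (Suc n))) * of_nat (Suc n) powr (1 - s) -
      (\<Sum>i\<le>K. pochhammer (s - 1) i / fact i *
        (of_real (hsum ks (Suc (Suc n))) * of_nat (Suc (Suc n)) powr (1 - s - of_nat i)))) sums
      (?D (s - 1) + V - ?a - (\<Sum>i\<le>K. pochhammer (s - 1) i / fact i * (?D (s - 1 + of_nat i) - ?a)))"
    by (intro sums_diff sums_sum sums_mult parts D)
  moreover have "of_real (hsum ks (Suc (Suc n))) * of_nat (Suc n) powr (1 - s) -
      (\<Sum>i\<le>K. pochhammer (s - 1) i / fact i *
        (of_real (hsum ks (Suc (Suc n))) * of_nat (Suc (Suc n)) powr (1 - s - of_nat i))) =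
      of_real (hsum ks (Suc (Suc n))) * powr_remainder K (Suc n) s" for n
    by (simp add: powr_remainder_def right_diff_distrib sum_distrib_left mult_ac del: of_nat_Suc)
  ultimately have "mzeta_remainder K ks s =
      ?D (s - 1) + V - ?a - (\<Sum>i\<le>K. pochhammer (s - 1) i / fact i * (?D (s - 1 + of_nat i) - ?a))"
    by (simp add: mzeta_remainder_def sums_iff)
  \<comment> \<open>The term i = 0 cancels \<open>?D (s - 1)\<close>, whose convergence is the
    reason for Re s > 2; the term i = 1 contains the value at \<open>s\<close> to be solved
    for.\<close>
  also have "{..K} = insert 0 (insert 1 {2..K})"
    using K by auto
  finally show ?thesis
    by (simp add: V_def algebra_simps)
qed

lemma mzeta_dirichlet_nice:
  assumes "is_index ks"
  shows "mzeta_dirichlet ks nicely_meromorphic_on {s. Re s > 1}"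
  using mzeta_dirichlet_holomorphic[OF assms]
  by (intro analytic_on_imp_nicely_meromorphic_on) (simp add: analytic_on_open)

text \<open>In the translation equation solved for the value at \<open>s\<close>, the sum begins at
  i = 2, so it needs the function only at least one unit further right. With
  \<open>K = Suc n\<close> the remainder is holomorphic on the enlarged half-plane.\<close>

lemma mzeta_dirichlet_continuation_step:
  assumes ks: "is_index ks" and V: "V meromorphic_on UNIV"
    and V_eq: "\<And>s. Re s > 2 \<Longrightarrow> V s = mzeta_shifted_tail ks mzeta_dirichlet s"
  shows "\<exists>f. f nicely_meromorphic_on {s. Re s > 1 - real n} \<and> (\<forall>s. Re s > 1 \<longrightarrow> f s = mzeta_dirichlet ks s)"
proof (induction n)
  case 0
  then show ?case
    using mzeta_dirichlet_nice[OF ks] by auto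
next
  case (Suc n)
  then obtain f where f: "f nicely_meromorphic_on {s. Re s > 1 - real n}"
    "\<And>s. Re s > 1 \<Longrightarrow> f s = mzeta_dirichlet ks s"
    by blast
  define S where "S = {s. Re s > 1 - real (Suc n)}"
  let ?a = "of_real (hsum ks 1) :: complex"
  define g where "g s = (V s - mzeta_remainder (Suc n) ks s -
    (\<Sum>i=2..Suc n. pochhammer (s - 1) i / fact i * (f (s - 1 + of_nat i) - ?a))) / (s - 1) + ?a" for s
  have g_eq: "g s = mzeta_dirichlet ks s" if s: "Re s > 2" for s
  proof -
    have "f (s - 1 + of_nat i) = mzeta_dirichlet ks (s - 1 + of_nat i)" for i
      using s by (intro f(2)) auto
    moreover have "s - 1 \<noteq> 0"
      using s by auto
    ultimately show ?thesis
      using mzeta_translation[OF ks s, of "Suc n"] s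
      by (simp add: g_def V_eq divide_simps algebra_simps)
  qed
  have "g meromorphic_on S"
    unfolding g_def
  proof (intro meromorphic_intros)
    show "V meromorphic_on S"
      using V by (rule meromorphic_on_subset) auto
    show "mzeta_remainder (Suc n) ks meromorphic_on S"
      unfolding S_def using mzeta_remainder_holomorphic[OF ks, of "Suc n"]
      by (intro analytic_on_imp_meromorphic_on) (simp add: analytic_on_open)
    show "(\<lambda>s. pochhammer (s - 1) i) meromorphic_on S" for i
    proof (rule analytic_on_imp_meromorphic_on, rule analytic_on_subset)
      show "(\<lambda>s. pochhammer (s - 1) i) analytic_on UNIV"
        unfolding analytic_on_open[OF open_UNIV] by (intro holomorphic_intros)
    qed auto
    show "(\<lambda>s. f (s - 1 + of_nat i)) meromorphic_on S" if "i \<in> {2..Suc n}" for i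
      by (rule meromorphic_on_compose[of f "{s. Re s > 1 - real n}"])
         (use f(1) that in \<open>auto simp: nicely_meromorphic_on_def S_def intro!: analytic_intros\<close>)
  qed
  then have nice: "remove_sings g nicely_meromorphic_on S"
    by (rule remove_sings_nicely_meromorphic)
  \<comment> \<open>The equation is available only for Re s > 2; the identity theorem carries the
    agreement to Re s > 1.\<close>
  have "remove_sings g s = mzeta_dirichlet ks s" if "Re s > 1" for s
  proof (rule nicely_meromorphic_eqI[where S = "{s. Re s > 1}" and U = "{s. Re s > 2}"
        and f = "remove_sings g" and g = "mzeta_dirichlet ks"])
    show "remove_sings g nicely_meromorphic_on {s. Re s > 1}"
      using nice by (rule nicely_meromorphic_on_subset) (auto simp: S_def)
    show "remove_sings g z = mzeta_dirichlet ks z" if z: "z \<in> {s. Re s > 2}" for z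
    proof -
      have "g holomorphic_on {s. Re s > 2}"
        by (rule holomorphic_transform[OF holomorphic_on_subset[OF mzeta_dirichlet_holomorphic[OF ks]]])
           (auto simp: g_eq)
      then have "g analytic_on {s. Re s > 2}"
        by (simp add: analytic_on_open)
      then have "g analytic_on {z}"
        by (rule analytic_on_subset) (use z in auto)
      then show ?thesis
        using g_eq z by simp
    qed
    show "{s. Re s > 2} \<noteq> {}"
      by (auto intro!: exI[of _ 3])
  qed (use that mzeta_dirichlet_nice[OF ks] in auto)
  then show ?case
    using nice unfolding S_def by blast
qed

text \<open>The inhomogeneous term \<open>V\<close> is the shifted continuation for the shorter
  index, which is why the induction runs over the index; for the empty index it is constant.\<close>

lemma mzeta_dirichlet_continuation:
  assumes "is_index ks"
  shows "\<exists>f. f nicely_meromorphic_on UNIV \<and> (\<forall>s. Re s > 1 \<longrightarrow> f s = mzeta_dirichlet ks s)"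
  using assms
proof (induction ks)
  have extend: "\<exists>f. f nicely_meromorphic_on UNIV \<and> (\<forall>s. Re s > 1 \<longrightarrow> f s = mzeta_dirichlet ks s)"
    if "is_index ks" "V meromorphic_on UNIV"
      "\<And>s. Re s > 2 \<Longrightarrow> V s = mzeta_shifted_tail ks mzeta_dirichlet s" for ks V
  proof -
    have "\<forall>n. \<exists>f. f nicely_meromorphic_on {s. Re s > 1 - real n} \<and> (\<forall>s. Re s > 1 \<longrightarrow> f s = mzeta_dirichlet ks s)"
      using mzeta_dirichlet_continuation_step[OF that] by blast
    then obtain F where F: "\<And>n. F n nicely_meromorphic_on {s. Re s > 1 - real n}"
      "\<And>n s. Re s > 1 \<Longrightarrow> F n s = mzeta_dirichlet ks s"
      by metis
    have "\<exists>f. f nicely_meromorphic_on UNIV \<and> (\<forall>s. Re s > 1 \<longrightarrow> f s = mzeta_dirichlet ks s) \<and>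
        (\<forall>n s. Re s > 1 - real n \<longrightarrow> f s = F n s)"
      by (rule nicely_meromorphic_glue) (fact F)+
    then show ?thesis
      by blast
  qed
  {
    case Nil
    show ?case
      by (rule extend[of _ "\<lambda>_. 1"]) (auto simp: mzeta_shifted_tail_def)
  next
    case (Cons k ks)
    then have "is_index ks"
      by (meson is_index_Cons)
    from Cons.IH[OF this] obtain f where f: "f nicely_meromorphic_on UNIV"
      "\<forall>s. Re s > 1 \<longrightarrow> f s = mzeta_dirichlet ks s"
      by blast
    show ?case
    proof (rule extend[of _ "\<lambda>s. f (s - 1 + of_nat k)"])
      show "(\<lambda>s. f (s - 1 + of_nat k)) meromorphic_on UNIV"
      proof (rule meromorphic_on_compose[of f UNIV])
        show "f meromorphic_on UNIV"
          using f(1) by (simp only: nicely_meromorphic_on_def)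
        show "(\<lambda>s. s - 1 + of_nat k) analytic_on UNIV"
          by (intro analytic_intros)
      qed simp
      show "f (s - 1 + of_nat k) = mzeta_shifted_tail (k # ks) mzeta_dirichlet s" if "Re s > 2" for s
        using that by (simp add: mzeta_shifted_tail_def f(2))
    qed (rule Cons.prems)
  }
qed

section \<open>Existence and uniqueness of the continuation that defines
  \<open>mzeta\<close>\<close>

lemma mzeta_properties:
  assumes "is_index ls"
  shows "mzeta ls nicely_meromorphic_on UNIV" "\<And>s. Re s > 1 \<Longrightarrow> mzeta ls s = mzeta_series ls s"
proof -
  let ?P = "\<lambda>f. f nicely_meromorphic_on UNIV \<and> (\<forall>s. Re s > 1 \<longrightarrow> f s = mzeta_series ls s)"
  obtain f where f: "?P f"
    using mzeta_dirichlet_continuation[of "rev ls"] assms by (auto simp: mzeta_series_eq)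
  have "?P (mzeta ls)"
    unfolding mzeta_def
  proof (rule theI[of ?P, OF f])
    fix g assume g: "?P g"
    show "g = f"
    proof
      fix z
      show "g z = f z"
      proof (rule nicely_meromorphic_eqI[where S = UNIV and U = "{s. Re s > 1}" and f = g and g = f])
        show "{s. Re s > 1} \<noteq> {}"
          by (auto intro!: exI[of _ 2])
      qed (use f g in auto)
    qed
  qed
  then show "mzeta ls nicely_meromorphic_on UNIV" "\<And>s. Re s > 1 \<Longrightarrow> mzeta ls s = mzeta_series ls s"
    by blast+
qed

subsection \<open>Holomorphic parameter integrals\<close>

text \<open>A closed disc of radius d/3 about a point of the ball of radius d/3 stays inside the
  ball of radius \<open>d\<close>; the Cauchy estimate there bounds the derivative by 3B/d.\<close>

lemma holomorphic_difference_quotient_bound: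
  fixes f :: "complex \<Rightarrow> complex"
  assumes f: "f holomorphic_on ball s d" and d: "d > 0" and B: "\<And>y. y \<in> ball s d \<Longrightarrow> norm (f y) \<le> B"
    and y: "y \<in> ball s (d / 3)"
  shows "norm (f y - f s) \<le> 3 * B / d * norm (y - s)"
proof -
  have deriv: "norm (deriv f z) \<le> 3 * B / d" if z: "z \<in> ball s (d / 3)" for z
  proof -
    have sub: "cball z (d / 3) \<subseteq> ball s d"
    proof
      fix w assume "w \<in> cball z (d / 3)"
      then show "w \<in> ball s d"
        using z dist_triangle[of s w z] d by auto
    qed
    have "norm ((deriv ^^ 1) f z) \<le> fact 1 * B / (d / 3) ^ 1"
    proof (rule Cauchy_inequality)
      show "f holomorphic_on ball z (d / 3)"
        by (rule holomorphic_on_subset[OF f]) (use sub ball_subset_cball in blast)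
      show "continuous_on (cball z (d / 3)) f"
        using holomorphic_on_subset[OF f sub] by (rule holomorphic_on_imp_continuous_on)
      show "norm (f w) \<le> B" if "norm (z - w) = d / 3" for w
        using that sub by (intro B) (auto simp: dist_norm)
    qed (use d in auto)
    then show ?thesis
      by (simp add: field_simps)
  qed
  show ?thesis
  proof (rule field_differentiable_bound[where S = "ball s (d / 3)" and f' = "deriv f"])
    show "(f has_field_derivative deriv f z) (at z within ball s (d / 3))" if "z \<in> ball s (d / 3)" for z
      by (rule has_field_derivative_at_within, rule holomorphic_derivI[OF f open_ball]) (use that d in auto)
    show "norm (deriv f z) \<le> 3 * B / d" if "z \<in> ball s (d / 3)" for z
      by (rule deriv[OF that])
    show "s \<in> ball s (d / 3)"
      using d by simp
  qed (rule convex_ball y)+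
qed

text \<open>A local bound on the integrand suffices: Cauchy's estimate converts it into one on the
  difference quotients, and dominated convergence along sequences differentiates under the
  integral.\<close>

lemma holomorphic_on_integral:
  fixes f :: "complex \<Rightarrow> 'a \<Rightarrow> complex"
  assumes S: "open S"
    and hol: "\<And>x. x \<in> space M \<Longrightarrow> (\<lambda>s. f s x) holomorphic_on S"
    and meas: "\<And>s. s \<in> S \<Longrightarrow> f s \<in> borel_measurable M"
    and dom: "\<And>s. s \<in> S \<Longrightarrow> \<exists>d w. d > 0 \<and> integrable M w \<and>
      (\<forall>y\<in>ball s d \<inter> S. \<forall>x\<in>space M. norm (f y x) \<le> w x)"
  shows "(\<lambda>s. \<integral>x. f s x \<partial>M) holomorphic_on S"
proof -
  have "(\<lambda>s. \<integral>x. f s x \<partial>M) field_differentiable (at s)" if s: "s \<in> S" for s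
  proof -
    obtain d0 w where d0: "d0 > 0" "integrable M w" "\<And>y x. y \<in> ball s d0 \<inter> S \<Longrightarrow> x \<in> space M \<Longrightarrow> norm (f y x) \<le> w x"
      using dom[OF s] by meson
    obtain d1 where d1: "d1 > 0" "ball s d1 \<subseteq> S"
      using S s open_contains_ball by blast
    define d where "d = min d0 d1"
    have d: "d > 0" "ball s d \<subseteq> S" and w: "\<And>y x. y \<in> ball s d \<Longrightarrow> x \<in> space M \<Longrightarrow> norm (f y x) \<le> w x"
      using d0 d1 by (auto simp: d_def subset_iff)
    have int: "integrable M (f y)" if "y \<in> ball s d" for y
      by (rule Bochner_Integration.integrable_bound[OF d0(2)])
         (use that d w[OF that] meas in \<open>auto intro!: AE_I2 intro: order_trans[OF _ abs_ge_self]\<close>)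
    let ?f' = "\<lambda>x. deriv (\<lambda>s. f s x) s"
    have lim: "((\<lambda>y. ((\<integral>x. f y x \<partial>M) - (\<integral>x. f s x \<partial>M)) / (y - s)) \<longlongrightarrow> (\<integral>x. ?f' x \<partial>M)) (at s)"
      unfolding tendsto_at_iff_sequentially
    proof (intro allI impI)
      fix X assume X: "\<forall>i. X i \<in> UNIV - {s}" "X \<longlonglongrightarrow> s"
      obtain N where N: "\<And>n. n \<ge> N \<Longrightarrow> X n \<in> ball s (d / 3)"
        using topological_tendstoD[OF X(2), of "ball s (d / 3)"] d(1)
        unfolding eventually_sequentially by auto
      define Y where "Y n = X (n + N)" for n
      have Y: "Y n \<in> ball s (d / 3)" "Y n \<noteq> s" "Y n \<in> ball s d" for n
        using N[of "n + N"] X(1) d(1) by (auto simp: Y_def)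
      have Ylim: "Y \<longlonglongrightarrow> s"
        unfolding Y_def by (rule LIMSEQ_ignore_initial_segment[OF X(2)])
      have quot: "(\<lambda>n. (f (Y n) x - f s x) / (Y n - s)) \<longlonglongrightarrow> ?f' x" if x: "x \<in> space M" for x
      proof -
        have "((\<lambda>s. f s x) has_field_derivative ?f' x) (at s)"
          by (rule holomorphic_derivI[OF hol[OF x] S s])
        then have "((\<lambda>y. (f y x - f s x) / (y - s)) \<longlongrightarrow> ?f' x) (at s)"
          by (simp add: has_field_derivative_iff)
        then show ?thesis
          unfolding tendsto_at_iff_sequentially using Y Ylim by (auto simp: o_def)
      qed
      have "(\<lambda>n. \<integral>x. (f (Y n) x - f s x) / (Y n - s) \<partial>M) \<longlonglongrightarrow> (\<integral>x. ?f' x \<partial>M)"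
      proof (rule integral_dominated_convergence[where w = "\<lambda>x. 3 * w x / d"])
        show m: "(\<lambda>x. (f (Y n) x - f s x) / (Y n - s)) \<in> borel_measurable M" for n
          using Y[of n] d s by (intro borel_measurable_divide borel_measurable_diff meas borel_measurable_const) auto
        show "?f' \<in> borel_measurable M"
          by (rule borel_measurable_LIMSEQ_metric[OF m]) (rule quot)
        show "integrable M (\<lambda>x. 3 * w x / d)"
          using d0(2) by auto
        show "AE x in M. (\<lambda>n. (f (Y n) x - f s x) / (Y n - s)) \<longlonglongrightarrow> ?f' x"
          by (intro AE_I2 quot)
        show "AE x in M. norm ((f (Y n) x - f s x) / (Y n - s)) \<le> 3 * w x / d" for n
        proof (intro AE_I2)
          fix x assume x: "x \<in> space M"
          have "norm (f (Y n) x - f s x) \<le> 3 * w x / d * norm (Y n - s)"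
            by (rule holomorphic_difference_quotient_bound[OF holomorphic_on_subset[OF hol[OF x] d(2)] d(1)])
               (use w x Y in auto)
          then show "norm ((f (Y n) x - f s x) / (Y n - s)) \<le> 3 * w x / d"
            using Y(2)[of n] by (simp add: norm_divide divide_le_eq)
        qed
      qed
      moreover have "(\<integral>x. (f (Y n) x - f s x) / (Y n - s) \<partial>M) =
          ((\<integral>x. f (Y n) x \<partial>M) - (\<integral>x. f s x \<partial>M)) / (Y n - s)" for n
        unfolding integral_divide_zero
        using Bochner_Integration.integral_diff[OF int[OF Y(3)[of n]] int[of s]] d(1) by simp
      ultimately have "(\<lambda>n. ((\<integral>x. f (Y n) x \<partial>M) - (\<integral>x. f s x \<partial>M)) / (Y n - s)) \<longlonglongrightarrow> (\<integral>x. ?f' x \<partial>M)"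
        by (simp only:)
      then show "((\<lambda>y. ((\<integral>x. f y x \<partial>M) - (\<integral>x. f s x \<partial>M)) / (y - s)) \<circ> X) \<longlonglongrightarrow> (\<integral>x. ?f' x \<partial>M)"
        unfolding Y_def o_def by (rule LIMSEQ_offset)
    qed
    then show ?thesis
      unfolding field_differentiable_def has_field_derivative_iff by blast
  qed
  then show ?thesis
    unfolding holomorphic_on_def using field_differentiable_at_within by blast
qed

subsection \<open>Mellin transforms of exponentials\<close>

lemma Gamma_kernel_integrable:
  assumes "Re z > 0" "a > 0"
  shows "set_integrable lborel {0<..} (\<lambda>t. complex_of_real t powr (z - 1) * of_real (exp (- (a * t))))"
proof -
  have "(\<lambda>t. complex_of_real t powr (z - 1) / of_real (exp (a * t))) absolutely_integrable_on {0<..}"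
    by (rule absolutely_integrable_Gamma_integral) fact+
  then have "integrable lebesgue (\<lambda>t. indicator {0<..} t *\<^sub>R (complex_of_real t powr (z - 1) * of_real (exp (- (a * t)))))"
    by (simp add: set_integrable_def exp_minus field_simps)
  then show ?thesis
    unfolding set_integrable_def by (subst (asm) integrable_completion) auto
qed

lemma Gamma_kernel_integral_1:
  assumes "Re z > 0"
  shows "(LINT t:{0<..}|lborel. complex_of_real t powr (z - 1) * of_real (exp (- t))) = Gamma z"
proof -
  let ?f = "\<lambda>t. complex_of_real t powr (z - 1) * of_real (exp (- t))"
  have "set_integrable lborel {0<..} ?f"
    using Gamma_kernel_integrable[OF assms, of 1] by simp
  then have "(LINT t:{0<..}|lborel. ?f t) = integral {0<..} ?f"
    by (rule set_borel_integral_eq_integral)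
  also have "(?f has_integral Gamma z) {0<..}"
    using Gamma_integral_complex'[OF assms] by (simp add: exp_minus field_simps)
  then have "integral {0<..} ?f = Gamma z"
    by (rule integral_unique)
  finally show ?thesis .
qed

lemma Gamma_kernel_integral:
  assumes "Re z > 0" "a > 0"
  shows "(LINT t:{0<..}|lborel. complex_of_real t powr (z - 1) * of_real (exp (- (a * t)))) = Gamma z * of_real a powr (- z)"
proof -
  let ?f = "\<lambda>t. indicator {0<..} t *\<^sub>R (complex_of_real t powr (z - 1) * of_real (exp (- t)))"
  have "Gamma z = (LINT t|lborel. ?f t)"
    using Gamma_kernel_integral_1[OF assms(1)] by (simp add: set_lebesgue_integral_def)
  also have "\<dots> = \<bar>a\<bar> *\<^sub>R (LINT t|lborel. ?f (0 + a * t))"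
    by (rule lborel_integral_real_affine) (use assms in auto)
  also have "(\<lambda>t. ?f (0 + a * t)) = (\<lambda>t. of_real a powr (z - 1) *
      (indicator {0<..} t *\<^sub>R (complex_of_real t powr (z - 1) * of_real (exp (- (a * t))))))"
  proof
    fix t
    show "?f (0 + a * t) = of_real a powr (z - 1) *
        (indicator {0<..} t *\<^sub>R (complex_of_real t powr (z - 1) * of_real (exp (- (a * t)))))"
    proof (cases "t > 0")
      case True
      then have "complex_of_real (a * t) powr (z - 1) = of_real a powr (z - 1) * of_real t powr (z - 1)"
        using assms by (simp add: powr_times_real)
      then show ?thesis
        using True assms by simp
    next
      case False
      then have "\<not> a * t > 0"
        using assms by (simp add: zero_less_mult_iff)
      then show ?thesis
        using False by simp
    qed
  qed
  also have "\<bar>a\<bar> *\<^sub>R (LINT t|lborel. of_real a powr (z - 1) *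
      (indicator {0<..} t *\<^sub>R (complex_of_real t powr (z - 1) * of_real (exp (- (a * t)))))) =
      (of_real a * of_real a powr (z - 1)) *
      (LINT t:{0<..}|lborel. complex_of_real t powr (z - 1) * of_real (exp (- (a * t))))"
    using assms by (simp add: set_lebesgue_integral_def scaleR_conv_of_real)
  also have "of_real a * of_real a powr (z - 1) = (of_real a powr z :: complex)"
    using assms by (simp add: powr_diff)
  finally show ?thesis
    using assms by (simp add: powr_minus field_simps)
qed

text \<open>The norms of the complex kernels have this form, so these integrals supply the absolute
  convergence in the Mellin transforms.\<close>

lemma Gamma_kernel_real:
  fixes x a :: real
  assumes "x > 0" "a > 0"
  shows "set_integrable lborel {0<..} (\<lambda>t. t powr (x - 1) * exp (- (a * t)))"
    and "(LINT t:{0<..}|lborel. t powr (x - 1) * exp (- (a * t))) = Gamma x * a powr (- x)"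
proof -
  have eq: "indicator {0<..} t *\<^sub>R (complex_of_real t powr (of_real x - 1) * of_real (exp (- (a * t)))) =
      of_real (indicator {0<..} t *\<^sub>R (t powr (x - 1) * exp (- (a * t))))" for t
    by (auto simp: indicator_def powr_of_real[symmetric])
  have "integrable lborel (\<lambda>t. complex_of_real (indicator {0<..} t *\<^sub>R (t powr (x - 1) * exp (- (a * t)))))"
    using Gamma_kernel_integrable[of "of_real x" a] assms unfolding set_integrable_def eq by simp
  then show "set_integrable lborel {0<..} (\<lambda>t. t powr (x - 1) * exp (- (a * t)))"
    unfolding set_integrable_def complex_of_real_integrable_eq .
  have "complex_of_real (LINT t:{0<..}|lborel. t powr (x - 1) * exp (- (a * t))) = Gamma (of_real x) * of_real a powr (- of_real x)"
    using Gamma_kernel_integral[of "of_real x" a] assms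
    unfolding set_lebesgue_integral_def eq by (simp only: integral_complex_of_real Re_complex_of_real simp_thms)
  also have "\<dots> = of_real (Gamma x * a powr (- x))"
    using assms by (simp add: Gamma_complex_of_real powr_of_real[symmetric])
  finally show "(LINT t:{0<..}|lborel. t powr (x - 1) * exp (- (a * t))) = Gamma x * a powr (- x)"
    by (simp only: of_real_eq_iff)
qed

lemma norm_of_real_powr: "t > 0 \<Longrightarrow> norm (complex_of_real t powr s) = t powr Re s"
  by (subst norm_powr_real_powr) auto

text \<open>Division by exp t - 1 turns the polylogarithm at exp(-t) into the series of
  \<open>hsum ks n * exp (- n t)\<close>. Termwise integration is legitimate because the integrals
  of the norms sum to Gamma(Re s) times the Dirichlet series at Re s.\<close>

lemma polylog_mellin:
  assumes ks: "is_index ks" and s: "Re s > 1"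
  shows "set_integrable lborel {0<..}
      (\<lambda>t. complex_of_real t powr (s - 1) * of_real (polylog ks (exp (- t)) / (exp t - 1)))" (is ?int)
    and "(LINT t:{0<..}|lborel. complex_of_real t powr (s - 1) * of_real (polylog ks (exp (- t)) / (exp t - 1))) =
      Gamma s * mzeta_dirichlet ks s" (is ?eq)
proof -
  define g where "g n t = complex_of_real t powr (s - 1) * of_real (exp (- (real (Suc n) * t)))" for n t
  define f where "f n t = of_real (hsum ks (Suc n)) * (indicator {0<..} t *\<^sub>R g n t)" for n t
  have g_int: "integrable lborel (\<lambda>t. indicator {0<..} t *\<^sub>R g n t)" for n
    using Gamma_kernel_integrable[of s "real (Suc n)"] s unfolding set_integrable_def g_def by simp
  have int: "integrable lborel (f n)" for n
    unfolding f_def by (intro integrable_mult_right g_int)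
  have f_integral: "(LINT t|lborel. f n t) = of_real (hsum ks (Suc n)) * (Gamma s * of_nat (Suc n) powr (- s))" for n
    unfolding f_def integral_mult_right_zero g_def
    using Gamma_kernel_integral[of s "real (Suc n)"] s
    by (simp add: set_lebesgue_integral_def del: of_nat_Suc)
  have norm_f: "norm (f n t) = hsum ks (Suc n) * (indicator {0<..} t *\<^sub>R (t powr (Re s - 1) * exp (- (real (Suc n) * t))))" for n t
    by (cases "t > 0") (simp_all add: f_def g_def norm_mult norm_of_real_powr hsum_nonneg del: of_nat_Suc)
  have "(LINT t|lborel. norm (f n t)) = Gamma (Re s) * (hsum ks (Suc n) * real (Suc n) powr (- Re s))" for n
    using Gamma_kernel_real(2)[of "Re s" "real (Suc n)"] s
    by (simp add: norm_f set_lebesgue_integral_def del: of_nat_Suc)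
  moreover have "summable (\<lambda>n. Gamma (Re s) * (hsum ks (Suc n) * real (Suc n) powr (- Re s)))"
    by (intro summable_mult summable_hsum_powr ks s)
  ultimately have norm_sum: "summable (\<lambda>n. LINT t|lborel. norm (f n t))"
    by (simp only:)
  have series: "(\<lambda>n. f n t) sums (indicator {0<..} t *\<^sub>R (complex_of_real t powr (s - 1) *
      of_real (polylog ks (exp (- t)) / (exp t - 1))))"
    and norm_series: "summable (\<lambda>n. norm (f n t))" for t
  proof -
    show "(\<lambda>n. f n t) sums (indicator {0<..} t *\<^sub>R (complex_of_real t powr (s - 1) *
        of_real (polylog ks (exp (- t)) / (exp t - 1))))"
    proof (cases "t > 0")
      case True
      have "(\<lambda>n. polylog_coeff 0 ks (Suc n) * exp (- t) ^ Suc n) sums polylog (0 # ks) (exp (- t))"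
        using polylog_sums[OF ks, of "exp (- t)" 0] True by (subst sums_Suc_iff) simp
      moreover have "polylog (0 # ks) (exp (- t)) = polylog ks (exp (- t)) / (exp t - 1)"
        using True by (simp add: polylog_Cons_0 ks exp_minus divide_simps)
      moreover have "polylog_coeff 0 ks (Suc n) * exp (- t) ^ Suc n = hsum ks (Suc n) * exp (- (real (Suc n) * t))" for n
        by (simp add: polylog_coeff_Suc exp_of_nat_mult[symmetric] del: of_nat_Suc power_Suc)
      ultimately have "(\<lambda>n. hsum ks (Suc n) * exp (- (real (Suc n) * t))) sums (polylog ks (exp (- t)) / (exp t - 1))"
        by (simp only:)
      then have "(\<lambda>n. complex_of_real (hsum ks (Suc n) * exp (- (real (Suc n) * t)))) sums
          of_real (polylog ks (exp (- t)) / (exp t - 1))"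
        by (subst sums_of_real_iff)
      from sums_mult[OF this, of "complex_of_real t powr (s - 1)"] show ?thesis
        using True by (simp add: f_def g_def mult_ac del: of_nat_Suc)
    qed (simp add: f_def)
    show "summable (\<lambda>n. norm (f n t))"
    proof (cases "t > 0")
      case True
      have "summable (\<lambda>n. polylog_coeff 0 ks (Suc n) * exp (- t) ^ Suc n)"
        using polylog_summable[OF ks, of "exp (- t)" 0] True
        by (subst summable_Suc_iff[of "\<lambda>n. polylog_coeff 0 ks n * exp (- t) ^ n"]) simp
      moreover have "polylog_coeff 0 ks (Suc n) * exp (- t) ^ Suc n = hsum ks (Suc n) * exp (- (real (Suc n) * t))" for n
        by (simp add: polylog_coeff_Suc exp_of_nat_mult[symmetric] del: of_nat_Suc power_Suc)
      ultimately have "summable (\<lambda>n. t powr (Re s - 1) * (hsum ks (Suc n) * exp (- (real (Suc n) * t))))"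
        by (simp only: summable_mult)
      then show ?thesis
        using True by (simp add: norm_f mult_ac del: of_nat_Suc)
    qed (simp add: f_def)
  qed
  have f_suminf: "(\<lambda>t. \<Sum>n. f n t) = (\<lambda>t. indicator {0<..} t *\<^sub>R (complex_of_real t powr (s - 1) *
      of_real (polylog ks (exp (- t)) / (exp t - 1))))"
    using series by (simp add: sums_iff fun_eq_iff)
  show ?int
    using integrable_suminf[OF int _ norm_sum] norm_series unfolding set_integrable_def f_suminf by simp
  have "(LINT t|lborel. (\<Sum>n. f n t)) = (\<Sum>n. LINT t|lborel. f n t)"
    by (rule integral_suminf[OF int _ norm_sum]) (use norm_series in simp)
  also have "(\<lambda>n. LINT t|lborel. f n t) = (\<lambda>n. Gamma s * (of_real (hsum ks (Suc n)) * of_nat (Suc n) powr (- s)))"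
    unfolding f_integral by (simp add: mult_ac)
  also have "(\<Sum>n. Gamma s * (of_real (hsum ks (Suc n)) * of_nat (Suc n) powr (- s))) = Gamma s * mzeta_dirichlet ks s"
    using sums_mult[OF mzeta_dirichlet_sums[OF ks s], of "Gamma s"] by (simp only: sums_iff)
  finally show ?eq
    unfolding f_suminf set_lebesgue_integral_def .
qed

subsection \<open>The integral representation\<close>

lemma Li_of_real:
  assumes ks: "is_index ks" "ks \<noteq> []" and x: "0 \<le> x" "x < 1"
  shows "Li ks (of_real x) = of_real (polylog (rev ks) x)"
proof -
  obtain ls k where ls: "ks = ls @ [k]"
    using ks(2) by (metis rev_exhaust)
  have idx: "is_index (rev ls)"
    using ks(1) ls by (simp add: is_index_def)
  define \<phi> :: "nat \<Rightarrow> complex" where "\<phi> m = of_real x ^ m / of_nat m ^ k" for m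
  have norm_\<phi>: "hsum (rev ls) (Suc n) * norm (\<phi> (Suc n)) = polylog_coeff k (rev ls) (Suc n) * x ^ Suc n" for n
    using x by (simp add: \<phi>_def norm_divide norm_mult norm_power polylog_coeff_Suc del: of_nat_Suc power_Suc)
  have sm: "(\<lambda>n. polylog_coeff k (rev ls) (Suc n) * x ^ Suc n) sums polylog (rev ks) x"
    using polylog_sums[OF idx, of x k] x ls by (subst sums_Suc_iff) simp
  have "Li ks (of_real x) = (\<Sum>\<^sub>\<infinity>ms\<in>incr_tuples (Suc (length ls)). \<phi> (last ms) / of_nat (tuple_weight ls ms))"
    unfolding Li_def ls length_append_singleton
  proof (rule infsum_cong)
    fix ms assume "ms \<in> incr_tuples (Suc (length ls))"
    then have "ms \<noteq> []" "length ms = Suc (length ls)"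
      by (auto simp: incr_tuples_def)
    then have last: "ms ! length ls = last ms"
      by (simp add: last_conv_nth)
    have "(\<Prod>i<Suc (length ls). (of_nat (ms ! i) :: complex) ^ ((ls @ [k]) ! i)) =
        (\<Prod>i<length ls. of_nat (ms ! i) ^ ((ls @ [k]) ! i)) * of_nat (last ms) ^ k"
      by (simp add: last)
    also have "(\<Prod>i<length ls. (of_nat (ms ! i) :: complex) ^ ((ls @ [k]) ! i)) = of_nat (tuple_weight ls ms)"
      by (simp add: nth_append)
    finally show "of_real x ^ last ms / (\<Prod>i<Suc (length ls). of_nat (ms ! i) ^ ((ls @ [k]) ! i)) =
        \<phi> (last ms) / of_nat (tuple_weight ls ms)"
      by (simp add: \<phi>_def field_simps del: prod.lessThan_Suc)
  qed
  also have "\<dots> = (\<Sum>n. of_real (hsum (rev ls) (Suc n)) * \<phi> (Suc n))"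
    by (rule infsum_incr_tuples_Suc) (use sm in \<open>simp only: norm_\<phi> sums_iff\<close>)
  also have "(\<lambda>n. of_real (hsum (rev ls) (Suc n)) * \<phi> (Suc n)) =
      (\<lambda>n. of_real (polylog_coeff k (rev ls) (Suc n) * x ^ Suc n))"
    by (simp add: \<phi>_def polylog_coeff_Suc fun_eq_iff del: of_nat_Suc power_Suc)
  also have "(\<Sum>n. of_real (polylog_coeff k (rev ls) (Suc n) * x ^ Suc n)) = complex_of_real (polylog (rev ks) x)"
    using sm unfolding sums_of_real_iff[where ?'a = complex, symmetric] by (simp only: sums_iff)
  finally show ?thesis .
qed

lemma xi_integral_eq:
  assumes "is_index ks" "ks \<noteq> []"
  shows "xi_integral ks s = rGamma s * (LINT t|lborel. indicator {0<..} t *\<^sub>R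
    (complex_of_real t powr (s - 1) * of_real (polylog (rev ks) (1 - exp (- t)) / (exp t - 1))))"
proof -
  have "indicator {0<..} t *\<^sub>R (complex_of_real t powr (s - 1) * Li ks (1 - exp (- complex_of_real t)) / (exp (of_real t) - 1)) =
      indicator {0<..} t *\<^sub>R (complex_of_real t powr (s - 1) * of_real (polylog (rev ks) (1 - exp (- t)) / (exp t - 1)))"
    for t :: real
  proof (cases "t > 0")
    case True
    have "1 - exp (- complex_of_real t) = of_real (1 - exp (- t))"
      by (simp flip: exp_of_real)
    then have "Li ks (1 - exp (- complex_of_real t)) = of_real (polylog (rev ks) (1 - exp (- t)))"
      using Li_of_real[OF assms, of "1 - exp (- t)"] True by (simp only:) simp
    then show ?thesis
      by (simp add: exp_of_real)
  qed simp
  then show ?thesis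
    by (simp only: xi_integral_def set_lebesgue_integral_def)
qed

text \<open>Gamma(s + j) / Gamma(s) is a Pochhammer symbol; the 1/j! comes from
  \<open>logpow\<close>.\<close>

lemma rGamma_mult_Gamma_shift:
  assumes "Re s > 0"
  shows "rGamma s * Gamma (s + of_nat j) / fact j = ((s + of_nat j - 1) gchoose j)"
proof -
  have "s \<notin> \<int>\<^sub>\<le>\<^sub>0"
    using assms by (auto elim!: nonpos_Ints_cases)
  then have "pochhammer s j = rGamma s * Gamma (s + of_nat j)"
    by (simp add: pochhammer_Gamma rGamma_inverse_Gamma field_simps)
  then show ?thesis
    by (simp add: gbinomial_pochhammer' algebra_simps)
qed

text \<open>With z = exp(-t) the factor \<open>logpow j z\<close> becomes t^j / j! and shifts the
  Mellin variable by \<open>j\<close>. For Re s > 1 all shifted arguments lie in the half-plane of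
  convergence, so the integral of the finite sum splits.\<close>

lemma xi_integral_connection:
  assumes ks: "is_index ks" "ks \<noteq> []" and s: "Re s > 1"
    and c: "\<And>z. z \<in> {0<..<1} \<Longrightarrow> polylog (rev ks) (1 - z) =
      (\<Sum>(ls, j)\<in>index_pairs w. c ls j * logpow j z * polylog (rev ls) z)"
  shows "xi_integral ks s = (\<Sum>(ls, j)\<in>index_pairs w.
    of_real (c ls j) * ((s + of_nat j - 1) gchoose j) * mzeta ls (s + of_nat j))"
proof -
  define h where "h ls j t = indicator {0<..} t *\<^sub>R (complex_of_real t powr (s + of_nat j - 1) *
      of_real (polylog (rev ls) (exp (- t)) / (exp t - 1)))" for ls j t
  have h: "integrable lborel (h ls j)" "(LINT t|lborel. h ls j t) = Gamma (s + of_nat j) * mzeta ls (s + of_nat j)"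
    if "is_index ls" for ls j
  proof -
    have "is_index (rev ls)" "Re (s + of_nat j) > 1"
      using that s by auto
    from polylog_mellin[OF this] show "integrable lborel (h ls j)"
      "(LINT t|lborel. h ls j t) = Gamma (s + of_nat j) * mzeta ls (s + of_nat j)"
      using \<open>Re (s + of_nat j) > 1\<close> that
      by (simp_all add: h_def[abs_def] set_integrable_def set_lebesgue_integral_def mzeta_properties(2) mzeta_series_eq)
  qed
  have "indicator {0<..} t *\<^sub>R (complex_of_real t powr (s - 1) * of_real (polylog (rev ks) (1 - exp (- t)) / (exp t - 1))) =
      (\<Sum>p\<in>index_pairs w. of_real (c (fst p) (snd p) / fact (snd p)) * h (fst p) (snd p) t)" for t
  proof (cases "t > 0")
    case True
    have pw: "complex_of_real t powr (s + of_nat j - 1) = of_real t powr (s - 1) * of_real (t ^ j)" for j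
    proof -
      have "s + of_nat j - 1 = (s - 1) + of_nat j"
        by simp
      then show ?thesis
        using True by (simp only: powr_add) (simp add: powr_nat')
    qed
    have "polylog (rev ks) (1 - exp (- t)) = (\<Sum>(ls, j)\<in>index_pairs w. c ls j * logpow j (exp (- t)) * polylog (rev ls) (exp (- t)))"
      using True by (intro c) auto
    also have "\<dots> = (\<Sum>p\<in>index_pairs w. c (fst p) (snd p) / fact (snd p) * (t ^ snd p * polylog (rev (fst p)) (exp (- t))))"
      by (simp add: logpow_def case_prod_unfold mult.assoc)
    finally have "complex_of_real t powr (s - 1) * of_real (polylog (rev ks) (1 - exp (- t)) / (exp t - 1)) =
        (\<Sum>p\<in>index_pairs w. complex_of_real t powr (s - 1) *
          of_real (c (fst p) (snd p) / fact (snd p) * (t ^ snd p * polylog (rev (fst p)) (exp (- t))) / (exp t - 1)))"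
      by (simp only: sum_divide_distrib of_real_sum sum_distrib_left)
    also have "\<dots> = (\<Sum>p\<in>index_pairs w. of_real (c (fst p) (snd p) / fact (snd p)) * h (fst p) (snd p) t)"
      using True by (intro sum.cong refl) (simp add: h_def pw)
    finally show ?thesis
      using True by simp
  qed (simp add: h_def)
  then have "xi_integral ks s = rGamma s * (LINT t|lborel. (\<Sum>p\<in>index_pairs w.
      of_real (c (fst p) (snd p) / fact (snd p)) * h (fst p) (snd p) t))"
    by (simp only: xi_integral_eq[OF ks])
  also have "(LINT t|lborel. (\<Sum>p\<in>index_pairs w. of_real (c (fst p) (snd p) / fact (snd p)) * h (fst p) (snd p) t)) =
      (\<Sum>p\<in>index_pairs w. LINT t|lborel. of_real (c (fst p) (snd p) / fact (snd p)) * h (fst p) (snd p) t)"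
    by (intro Bochner_Integration.integral_sum integrable_mult_right h) (auto simp: index_pairs_def)
  also have "\<dots> = (\<Sum>p\<in>index_pairs w. of_real (c (fst p) (snd p) / fact (snd p)) *
      (Gamma (s + of_nat (snd p)) * mzeta (fst p) (s + of_nat (snd p))))"
    by (intro sum.cong refl, subst integral_mult_right_zero, subst h(2)) (auto simp: index_pairs_def)
  also have "rGamma s * \<dots> = (\<Sum>p\<in>index_pairs w. of_real (c (fst p) (snd p)) *
      (rGamma s * Gamma (s + of_nat (snd p)) / fact (snd p)) * mzeta (fst p) (s + of_nat (snd p)))"
    unfolding sum_distrib_left by (intro sum.cong refl) simp
  also have "\<dots> = (\<Sum>p\<in>index_pairs w. of_real (c (fst p) (snd p)) *
      ((s + of_nat (snd p) - 1) gchoose (snd p)) * mzeta (fst p) (s + of_nat (snd p)))"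
    using s by (simp only: rGamma_mult_Gamma_shift[of s] order.strict_trans[OF zero_less_one])
  finally show ?thesis
    by (simp only: case_prod_unfold)
qed

subsection \<open>The entire continuation\<close>

text \<open>
  For the index \<open>k # ks\<close> the integrand is \<open>t powr (s - 1) * exp (-t) * Q (1 - exp (-t))\<close> with
  \<open>Q x = polylog (k # ks) x / x\<close>. After division by \<open>Gamma s\<close>, the Mellin transform of each term of
  the power series \<open>Q\<close> is entire, and that of the tail of order \<open>N\<close> is holomorphic for \<open>Re s > - N\<close>.
\<close>

definition polylog_tail :: "nat \<Rightarrow> nat list \<Rightarrow> nat \<Rightarrow> real \<Rightarrow> real" where
  "polylog_tail k ks N x = (\<Sum>n. polylog_coeff k ks (Suc (n + N)) * x ^ n)"

lemma polylog_tail_summable: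
  assumes "is_index ks" "\<bar>x\<bar> < 1"
  shows "summable (\<lambda>n. polylog_coeff k ks (Suc (n + N)) * x ^ n)"
  using summable_powser_ignore_initial_segment[of "polylog_coeff k ks" "Suc N" x] polylog_summable[OF assms, of k]
  by simp

lemma polylog_tail_nonneg:
  assumes "is_index ks" "0 \<le> x" "x < 1"
  shows "polylog_tail k ks N x \<ge> 0"
  unfolding polylog_tail_def
  by (intro suminf_nonneg polylog_tail_summable) (use assms in \<open>auto simp: polylog_coeff_nonneg\<close>)

lemma polylog_tail_mono:
  assumes "is_index ks" "0 \<le> x" "x \<le> y" "y < 1"
  shows "polylog_tail k ks N x \<le> polylog_tail k ks N y"
  unfolding polylog_tail_def
  by (intro suminf_le polylog_tail_summable mult_left_mono power_mono) (use assms in \<open>auto simp: polylog_coeff_nonneg\<close>)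

lemma polylog_mono:
  assumes "is_index ks" "0 \<le> x" "x \<le> y" "y < 1"
  shows "polylog ks x \<le> polylog ks y"
proof (cases ks)
  case (Cons k ls)
  then show ?thesis
    unfolding Cons polylog.simps(2)
    by (intro suminf_le polylog_summable mult_left_mono power_mono) (use assms Cons in \<open>auto simp: polylog_coeff_nonneg\<close>)
qed simp

lemma polylog_eq_tail:
  assumes "is_index ks" "\<bar>x\<bar> < 1"
  shows "polylog (k # ks) x = x * ((\<Sum>n<N. polylog_coeff k ks (Suc n) * x ^ n) + x ^ N * polylog_tail k ks N x)"
proof -
  have "polylog (k # ks) x = (\<Sum>n. polylog_coeff k ks (n + Suc N) * x ^ (n + Suc N)) + (\<Sum>n<Suc N. polylog_coeff k ks n * x ^ n)"
    unfolding polylog.simps(2) by (rule suminf_split_initial_segment[OF polylog_summable[OF assms]])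
  also have "(\<lambda>n. polylog_coeff k ks (n + Suc N) * x ^ (n + Suc N)) = (\<lambda>n. x ^ Suc N * (polylog_coeff k ks (Suc (n + N)) * x ^ n))"
    by (simp add: fun_eq_iff power_add mult_ac)
  also have "(\<Sum>n. x ^ Suc N * (polylog_coeff k ks (Suc (n + N)) * x ^ n)) = x ^ Suc N * polylog_tail k ks N x"
    unfolding polylog_tail_def by (rule suminf_mult[OF polylog_tail_summable[OF assms]])
  also have "(\<Sum>n<Suc N. polylog_coeff k ks n * x ^ n) = x * (\<Sum>n<N. polylog_coeff k ks (Suc n) * x ^ n)"
    by (subst sum.lessThan_Suc_shift) (simp add: sum_distrib_left mult_ac)
  finally show ?thesis
    by (simp add: algebra_simps)
qed

section \<open>Growth of the polylogarithm and its tails at 1 - exp(-t)\<close>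

lemma power_div_fact_le_exp:
  fixes x :: real
  assumes "x \<ge> 0"
  shows "x ^ j / fact j \<le> exp x"
proof -
  have "(\<Sum>n\<in>{j}. x ^ n /\<^sub>R fact n) \<le> (\<Sum>n. x ^ n /\<^sub>R fact n)"
  proof (rule sum_le_suminf)
    show "summable (\<lambda>n. x ^ n /\<^sub>R fact n)"
      by (rule summable_exp_generic)
    show "0 \<le> x ^ n /\<^sub>R fact n" for n
      using assms by simp
  qed simp
  then show ?thesis
    by (simp add: exp_def divide_inverse mult.commute)
qed

text \<open>By the connection formula the function is a polynomial in t with coefficients bounded
  for t \<ge> 1. The rate 1/2 leaves half of the factor exp(-t) for integrability; 2^j comes from
  estimating (t/2)^j / j! by exp(t/2).\<close>

lemma polylog_growth:
  assumes "is_index ks"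
  obtains C where "C \<ge> 0" "\<And>t. t \<ge> 1 \<Longrightarrow> polylog ks (1 - exp (- t)) \<le> C * exp (t / 2)"
proof -
  obtain c where c: "\<And>z. z \<in> {0<..<1} \<Longrightarrow> polylog ks (1 - z) =
      (\<Sum>(ls, j)\<in>index_pairs (sum_list ks). c ls j * logpow j z * polylog (rev ls) z)"
    using connection_formula[OF assms] unfolding polylog_combination_def by blast
  define C where "C = (\<Sum>(ls, j)\<in>index_pairs (sum_list ks). \<bar>c ls j\<bar> * (2 ^ j * polylog (rev ls) (exp (- 1))))"
  have "polylog ks (1 - exp (- t)) \<le> C * exp (t / 2)" if t: "t \<ge> 1" for t
  proof -
    have "polylog ks (1 - exp (- t)) = (\<Sum>(ls, j)\<in>index_pairs (sum_list ks). c ls j * logpow j (exp (- t)) * polylog (rev ls) (exp (- t)))"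
      using t by (intro c) auto
    also have "\<dots> \<le> (\<Sum>(ls, j)\<in>index_pairs (sum_list ks). \<bar>c ls j\<bar> * (2 ^ j * polylog (rev ls) (exp (- 1))) * exp (t / 2))"
      unfolding case_prod_unfold
    proof (rule sum_mono)
      fix p assume "p \<in> index_pairs (sum_list ks)"
      then have idx: "is_index (rev (fst p))"
        by (auto simp: index_pairs_def)
      let ?j = "snd p" and ?L = "polylog (rev (fst p))"
      have L: "0 \<le> ?L (exp (- t))" "?L (exp (- t)) \<le> ?L (exp (- 1))"
        using t by (auto intro!: polylog_nonneg polylog_mono idx)
      have "(t / 2) ^ ?j / fact ?j \<le> exp (t / 2)"
        using t by (intro power_div_fact_le_exp) simp
      then have "2 ^ ?j * ((t / 2) ^ ?j / fact ?j) \<le> 2 ^ ?j * exp (t / 2)"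
        by (rule mult_left_mono) simp
      then have lp: "logpow ?j (exp (- t)) \<le> 2 ^ ?j * exp (t / 2)"
        by (simp add: logpow_def power_divide)
      have lp0: "0 \<le> logpow ?j (exp (- t))"
        using t by (simp add: logpow_def)
      have "c (fst p) ?j * logpow ?j (exp (- t)) * ?L (exp (- t)) \<le> \<bar>c (fst p) ?j\<bar> * (logpow ?j (exp (- t)) * ?L (exp (- t)))"
        using L(1) lp0 by (simp add: mult.assoc mult_right_mono)
      also have "\<dots> \<le> \<bar>c (fst p) ?j\<bar> * ((2 ^ ?j * exp (t / 2)) * ?L (exp (- 1)))"
        by (intro mult_left_mono mult_mono lp L) auto
      finally show "c (fst p) ?j * logpow ?j (exp (- t)) * ?L (exp (- t)) \<le>
          \<bar>c (fst p) ?j\<bar> * (2 ^ ?j * ?L (exp (- 1))) * exp (t / 2)"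
        by (simp add: mult_ac)
    qed
    also have "\<dots> = C * exp (t / 2)"
      by (simp add: C_def sum_distrib_right case_prod_unfold)
    finally show ?thesis .
  qed
  moreover have "C \<ge> 0"
    unfolding C_def by (auto intro!: sum_nonneg mult_nonneg_nonneg polylog_nonneg simp: index_pairs_def)
  ultimately show ?thesis
    using that by blast
qed

text \<open>For t \<le> 1 the tail is at most its value at t = 1. Beyond that, x = 1 - exp(-t) is
  bounded below by x1 = 1 - exp(-1), and x^(N+1) times the tail is part of a polylogarithm with
  nonnegative terms.\<close>

lemma polylog_tail_growth:
  assumes "is_index (k # ks)"
  obtains C where "C \<ge> 0" "\<And>t. t > 0 \<Longrightarrow> polylog_tail k ks N (1 - exp (- t)) \<le> C * exp (t / 2)"
proof -
  have ks: "is_index ks"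
    using assms by simp
  obtain C1 where C1: "C1 \<ge> 0" "\<And>t. t \<ge> 1 \<Longrightarrow> polylog (k # ks) (1 - exp (- t)) \<le> C1 * exp (t / 2)"
    using polylog_growth[OF assms] by blast
  define x1 where "x1 = 1 - exp (- 1 :: real)"
  have x1: "0 < x1" "x1 < 1"
    by (simp_all add: x1_def)
  define C2 where "C2 = polylog_tail k ks N x1"
  have C2: "C2 \<ge> 0"
    unfolding C2_def using x1 by (intro polylog_tail_nonneg ks) auto
  define C where "C = C2 + C1 / x1 ^ Suc N"
  have C: "C \<ge> 0"
    using C1(1) C2 x1 by (simp add: C_def)
  have "polylog_tail k ks N (1 - exp (- t)) \<le> C * exp (t / 2)" if t: "t > 0" for t
  proof (cases "t \<le> 1")
    case True
    have "polylog_tail k ks N (1 - exp (- t)) \<le> C2"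
      unfolding C2_def using True t x1 by (intro polylog_tail_mono ks) (auto simp: x1_def)
    also have "\<dots> \<le> C"
      unfolding C_def using C1(1) x1 by simp
    also have "\<dots> \<le> C * exp (t / 2)"
      using mult_left_mono[OF _ C, of 1 "exp (t / 2)"] t by simp
    finally show ?thesis .
  next
    case False
    define x where "x = 1 - exp (- t)"
    have x: "x1 \<le> x" "x < 1"
      using False by (auto simp: x_def x1_def)
    have tail: "0 \<le> polylog_tail k ks N x"
      using x x1 by (intro polylog_tail_nonneg ks) auto
    have "x1 ^ Suc N * polylog_tail k ks N x \<le> x ^ Suc N * polylog_tail k ks N x"
      using x x1 tail by (intro mult_right_mono power_mono) auto
    also have "\<dots> \<le> polylog (k # ks) x"
    proof -
      have "0 \<le> x * (\<Sum>n<N. polylog_coeff k ks (Suc n) * x ^ n)"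
        using x x1 by (intro mult_nonneg_nonneg sum_nonneg) (auto simp: polylog_coeff_nonneg)
      then show ?thesis
        using polylog_eq_tail[OF ks, of x k N] x x1 by (simp add: algebra_simps)
    qed
    also have "\<dots> \<le> C1 * exp (t / 2)"
      unfolding x_def using False by (intro C1) auto
    finally have "polylog_tail k ks N x \<le> C1 * exp (t / 2) / x1 ^ Suc N"
      using x1 by (simp add: pos_le_divide_eq mult.commute)
    also have "\<dots> \<le> C * exp (t / 2)"
      using C2 by (simp add: C_def distrib_right)
    finally show ?thesis
      by (simp add: x_def)
  qed
  then show ?thesis
    using that C by blast
qed

definition xi_tail_kernel :: "nat \<Rightarrow> nat list \<Rightarrow> nat \<Rightarrow> complex \<Rightarrow> real \<Rightarrow> complex" where
  "xi_tail_kernel k ks N s t = indicator {0<..} t *\<^sub>R (complex_of_real t powr (s - 1) *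
     of_real (exp (- t) * (1 - exp (- t)) ^ N * polylog_tail k ks N (1 - exp (- t))))"

lemma xi_tail_kernel_measurable [measurable]: "xi_tail_kernel k ks N s \<in> borel_measurable lborel"
  unfolding xi_tail_kernel_def[abs_def] polylog_tail_def by measurable

text \<open>Near 0 the factor (1 - exp(-t))^N is at most t^N and shifts the critical exponent by
  \<open>N\<close>; at infinity exp(-t/2) remains. The powers at both ends \<open>a\<close> and
  \<open>b\<close> of the strip dominate all powers in between, for t < 1 and t \<ge> 1
  respectively.\<close>

lemma xi_tail_kernel_dominated:
  assumes ks: "is_index (k # ks)" and a: "a > - real N" and ab: "a \<le> b"
  obtains w where "integrable lborel w" "\<And>s t. a \<le> Re s \<Longrightarrow> Re s \<le> b \<Longrightarrow> norm (xi_tail_kernel k ks N s t) \<le> w t"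
proof -
  obtain C where C: "C \<ge> 0" "\<And>t. t > 0 \<Longrightarrow> polylog_tail k ks N (1 - exp (- t)) \<le> C * exp (t / 2)"
    using polylog_tail_growth[OF ks] by blast
  define v where "v y t = indicator {0<..} t *\<^sub>R (t powr (y + real N - 1) * exp (- (1 / 2 * t)))" for y t :: real
  have v: "integrable lborel (v y)" if "y \<ge> a" for y
    using Gamma_kernel_real(1)[of "y + real N" "1 / 2"] that a by (simp add: set_integrable_def v_def[abs_def])
  show ?thesis
  proof
    show "integrable lborel (\<lambda>t. C * (v a t + v b t))"
      using ab by (intro integrable_mult_right Bochner_Integration.integrable_add v) auto
    fix s t assume s: "a \<le> Re s" "Re s \<le> b"
    show "norm (xi_tail_kernel k ks N s t) \<le> C * (v a t + v b t)"
    proof (cases "t > 0")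
      case True
      let ?x = "1 - exp (- t)"
      have x: "0 \<le> ?x" "?x < 1" "?x \<le> t"
        using True exp_ge_add_one_self[of "- t"] by auto
      have tail: "0 \<le> polylog_tail k ks N ?x"
        using ks x by (intro polylog_tail_nonneg) auto
      have "norm (xi_tail_kernel k ks N s t) = t powr (Re s - 1) * (exp (- t) * ?x ^ N * polylog_tail k ks N ?x)"
        using True x tail by (simp add: xi_tail_kernel_def norm_mult norm_of_real_powr abs_mult norm_power
            flip: of_real_power)
      also have "\<dots> \<le> (t powr (a - 1) + t powr (b - 1)) * (exp (- t) * t ^ N * (C * exp (t / 2)))"
      proof (intro mult_mono power_mono C(2) True x)
        show "t powr (Re s - 1) \<le> t powr (a - 1) + t powr (b - 1)"
        proof (cases "t \<ge> 1")
          case True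
          then have "t powr (Re s - 1) \<le> t powr (b - 1)"
            using s by (intro powr_mono) auto
          then show ?thesis
            by (simp add: add_increasing)
        next
          case False
          then have "t powr (Re s - 1) \<le> t powr (a - 1)"
            using s \<open>t > 0\<close> by (intro powr_mono') auto
          then show ?thesis
            by (simp add: add_increasing2)
        qed
      qed (use True x tail in auto)
      also have "\<dots> = C * (v a t + v b t)"
      proof -
        have "t powr (y - 1) * t ^ N = t powr (y + real N - 1)" for y
          using True by (simp add: powr_diff powr_add powr_realpow)
        moreover have "exp (- t) * exp (t / 2) = exp (- (1 / 2 * t))"
          by (simp flip: exp_add)
        ultimately have "t powr (y - 1) * (exp (- t) * t ^ N * (C * exp (t / 2))) = C * v y t" for y
        proof -
          have "t powr (y - 1) * (exp (- t) * t ^ N * (C * exp (t / 2))) =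
              C * ((t powr (y - 1) * t ^ N) * (exp (- t) * exp (t / 2)))"
            by (simp only: mult_ac)
          also have "\<dots> = C * v y t"
            unfolding \<open>\<And>y. t powr (y - 1) * t ^ N = t powr (y + real N - 1)\<close>
              \<open>exp (- t) * exp (t / 2) = exp (- (1 / 2 * t))\<close>
            using True by (simp add: v_def)
          finally show ?thesis .
        qed
        then show ?thesis
          by (simp only: distrib_left distrib_right)
      qed
      finally show ?thesis .
    qed (simp add: xi_tail_kernel_def v_def)
  qed
qed

lemma xi_tail_kernel_integrable:
  assumes "is_index (k # ks)" "Re s > - real N"
  shows "integrable lborel (xi_tail_kernel k ks N s)"
proof -
  obtain w where w: "integrable lborel w" "\<And>s' t. Re s \<le> Re s' \<Longrightarrow> Re s' \<le> Re s \<Longrightarrow> norm (xi_tail_kernel k ks N s' t) \<le> w t"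
    using xi_tail_kernel_dominated[OF assms, of "Re s"] by blast
  show ?thesis
    by (rule Bochner_Integration.integrable_bound[OF w(1)])
       (auto intro!: AE_I2 order_trans[OF w(2) abs_ge_self])
qed

lemma xi_tail_holomorphic:
  assumes "is_index (k # ks)"
  shows "(\<lambda>s. LINT t|lborel. xi_tail_kernel k ks N s t) holomorphic_on {s. Re s > - real N}"
proof (rule holomorphic_on_integral)
  show "(\<lambda>s. xi_tail_kernel k ks N s t) holomorphic_on {s. Re s > - real N}" for t
    unfolding xi_tail_kernel_def
    by (cases "t > 0") (auto intro!: holomorphic_intros)
  fix s assume s: "s \<in> {s. Re s > - real N}"
  define d where "d = (Re s + real N) / 2"
  have d: "d > 0" "Re s - d > - real N"
    using s by (auto simp: d_def field_simps)
  obtain w where w: "integrable lborel w"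
    "\<And>s' t. Re s - d \<le> Re s' \<Longrightarrow> Re s' \<le> Re s + d \<Longrightarrow> norm (xi_tail_kernel k ks N s' t) \<le> w t"
    using xi_tail_kernel_dominated[OF assms d(2), of "Re s + d"] d(1) by auto
  show "\<exists>d w. d > 0 \<and> integrable lborel w \<and> (\<forall>y\<in>ball s d \<inter> {s. Re s > - real N}.
      \<forall>t\<in>space lborel. norm (xi_tail_kernel k ks N y t) \<le> w t)"
  proof (intro exI[of _ d] exI[of _ w] conjI ballI d(1) w)
    fix y assume "y \<in> ball s d \<inter> {s. Re s > - real N}"
    then have "\<bar>Re s - Re y\<bar> < d"
      using abs_Re_le_cmod[of "s - y"] by (auto simp: dist_norm)
    then show "Re s - d \<le> Re y" "Re y \<le> Re s + d"
      by linarith+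
  qed
qed (auto simp: open_halfspace_Re_gt)

text \<open>The Mellin transform of exp(-t) (1 - exp(-t))^n over Gamma(s), by the binomial theorem.
  As a finite sum of exponentials in s it is entire.\<close>

definition xi_term :: "nat \<Rightarrow> complex \<Rightarrow> complex" where
  "xi_term n s = (\<Sum>i\<le>n. of_nat (n choose i) * (- 1) ^ i * of_nat (Suc i) powr (- s))"

definition xi_term_kernel :: "nat \<Rightarrow> complex \<Rightarrow> real \<Rightarrow> complex" where
  "xi_term_kernel n s t = indicator {0<..} t *\<^sub>R (complex_of_real t powr (s - 1) *
     of_real (exp (- t) * (1 - exp (- t)) ^ n))"

lemma xi_term_mellin:
  assumes "Re s > 0"
  shows "integrable lborel (xi_term_kernel n s)"
    and "(LINT t|lborel. xi_term_kernel n s t) = Gamma s * xi_term n s"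
proof -
  define g where "g i t = indicator {0<..} t *\<^sub>R (complex_of_real t powr (s - 1) * of_real (exp (- (real (Suc i) * t))))" for i t
  have g: "integrable lborel (g i)" "(LINT t|lborel. g i t) = Gamma s * of_nat (Suc i) powr (- s)" for i
    using Gamma_kernel_integrable[of s "real (Suc i)"] Gamma_kernel_integral[of s "real (Suc i)"] assms
    by (simp_all add: g_def[abs_def] set_integrable_def set_lebesgue_integral_def del: of_nat_Suc)
  have eq: "xi_term_kernel n s t = (\<Sum>i\<le>n. (of_nat (n choose i) * (- 1) ^ i) * g i t)" for t
  proof -
    have "exp (- t) * (1 - exp (- t)) ^ n = exp (- t) * (- exp (- t) + 1) ^ n"
      by simp
    also have "\<dots> = (\<Sum>i\<le>n. real (n choose i) * (- 1) ^ i * exp (- (real (Suc i) * t)))"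
      unfolding binomial_ring sum_distrib_left
    proof (rule sum.cong[OF refl])
      fix i
      have "exp (- (real (Suc i) * t)) = exp (- t) * exp (- t) ^ i"
        by (simp add: exp_of_nat_mult[symmetric] exp_add[symmetric] algebra_simps)
      then show "exp (- t) * (of_nat (n choose i) * (- exp (- t)) ^ i * 1 ^ (n - i)) =
          real (n choose i) * (- 1) ^ i * exp (- (real (Suc i) * t))"
        by (simp add: power_minus[of "exp (- t)"] mult_ac)
    qed
    finally show ?thesis
      by (simp add: xi_term_kernel_def g_def sum_distrib_left scaleR_sum_right mult_ac
          del: of_nat_Suc)
  qed
  have eq': "xi_term_kernel n s = (\<lambda>t. \<Sum>i\<le>n. (of_nat (n choose i) * (- 1) ^ i) * g i t)"
    using eq by blast
  show "integrable lborel (xi_term_kernel n s)"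
    unfolding eq' by (intro Bochner_Integration.integrable_sum integrable_mult_right g)
  have "(LINT t|lborel. xi_term_kernel n s t) = (\<Sum>i\<le>n. LINT t|lborel. (of_nat (n choose i) * (- 1) ^ i) * g i t)"
    unfolding eq' by (intro Bochner_Integration.integral_sum integrable_mult_right g)
  also have "\<dots> = Gamma s * xi_term n s"
    unfolding integral_mult_right_zero g(2) xi_term_def sum_distrib_left by (simp only: mult_ac)
  finally show "(LINT t|lborel. xi_term_kernel n s t) = Gamma s * xi_term n s" .
qed

definition xi_continuation :: "nat \<Rightarrow> nat list \<Rightarrow> nat \<Rightarrow> complex \<Rightarrow> complex" where
  "xi_continuation k ks N s = (\<Sum>n<N. of_real (polylog_coeff k ks (Suc n)) * xi_term n s) +
     rGamma s * (LINT t|lborel. xi_tail_kernel k ks N s t)"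

lemma xi_continuation_holomorphic:
  assumes "is_index (k # ks)"
  shows "xi_continuation k ks N holomorphic_on {s. Re s > - real N}"
  unfolding xi_continuation_def[abs_def] xi_term_def
  by (intro holomorphic_intros xi_tail_holomorphic assms holomorphic_on_subset[OF holomorphic_rGamma]) auto

text \<open>With x = 1 - exp(-t) the quotient x / (exp t - 1) is exp(-t): the zero of the
  polylogarithm at x = 0 cancels the pole of the kernel at t = 0.\<close>

lemma xi_integrand_split:
  assumes "is_index (k # ks)"
  shows "indicator {0<..} t *\<^sub>R (complex_of_real t powr (s - 1) * of_real (polylog (k # ks) (1 - exp (- t)) / (exp t - 1))) =
    (\<Sum>n<N. of_real (polylog_coeff k ks (Suc n)) * xi_term_kernel n s t) + xi_tail_kernel k ks N s t"
proof (cases "t > 0")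
  case True
  let ?x = "1 - exp (- t)"
  have "?x / (exp t - 1) = exp (- t)"
    using True by (simp add: exp_minus field_simps)
  moreover have "polylog (k # ks) ?x = ?x * ((\<Sum>n<N. polylog_coeff k ks (Suc n) * ?x ^ n) + ?x ^ N * polylog_tail k ks N ?x)"
    using assms True by (intro polylog_eq_tail) auto
  ultimately have "polylog (k # ks) ?x / (exp t - 1) =
      exp (- t) * ((\<Sum>n<N. polylog_coeff k ks (Suc n) * ?x ^ n) + ?x ^ N * polylog_tail k ks N ?x)"
    by (metis times_divide_eq_left)
  also have "\<dots> = (\<Sum>n<N. polylog_coeff k ks (Suc n) * (exp (- t) * ?x ^ n)) + exp (- t) * ?x ^ N * polylog_tail k ks N ?x"
    by (simp only: distrib_left sum_distrib_left mult_ac)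
  finally show ?thesis
    using True
    by (simp only: xi_term_kernel_def xi_tail_kernel_def of_real_add of_real_sum of_real_mult distrib_left
        sum_distrib_left indicator_simps greaterThan_iff scaleR_one mult_ac)
qed (simp add: xi_term_kernel_def xi_tail_kernel_def)

text \<open>The split integral may be evaluated term by term in two situations: for Re s > 0 every
  term is integrable, and if the first \<open>N\<close> coefficients vanish the tail is the whole
  integrand.\<close>

lemma xi_continuation_eq_integral:
  assumes ks: "is_index ks" "rev ks = k # ls" and s: "Re s > - real N"
    and low: "Re s > 0 \<or> (\<forall>n<N. polylog_coeff k ls (Suc n) = 0)"
  shows "xi_continuation k ls N s = xi_integral ks s"
proof -
  have idx: "is_index (k # ls)"
    using ks by (metis is_index_rev)
  have ne: "ks \<noteq> []"
    using ks by auto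
  have terms: "integrable lborel (\<lambda>t. of_real (polylog_coeff k ls (Suc n)) * xi_term_kernel n s t)"
    "rGamma s * (LINT t|lborel. of_real (polylog_coeff k ls (Suc n)) * xi_term_kernel n s t) =
      of_real (polylog_coeff k ls (Suc n)) * xi_term n s" if "n < N" for n
  proof -
    consider "Re s > 0" | "polylog_coeff k ls (Suc n) = 0"
      using low \<open>n < N\<close> by blast
    then have "integrable lborel (\<lambda>t. of_real (polylog_coeff k ls (Suc n)) * xi_term_kernel n s t) \<and>
      rGamma s * (LINT t|lborel. of_real (polylog_coeff k ls (Suc n)) * xi_term_kernel n s t) =
      of_real (polylog_coeff k ls (Suc n)) * xi_term n s"
    proof cases
      case 1
      then have "rGamma s * Gamma s = 1"
        using rGamma_mult_Gamma_shift[of s 0] by simp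
      with xi_term_mellin[OF 1, of n] show ?thesis
        by (simp add: mult_ac)
    qed simp
    then show "integrable lborel (\<lambda>t. of_real (polylog_coeff k ls (Suc n)) * xi_term_kernel n s t)"
      "rGamma s * (LINT t|lborel. of_real (polylog_coeff k ls (Suc n)) * xi_term_kernel n s t) =
        of_real (polylog_coeff k ls (Suc n)) * xi_term n s"
      by blast+
  qed
  have "xi_integral ks s = rGamma s * (LINT t|lborel.
      (\<Sum>n<N. of_real (polylog_coeff k ls (Suc n)) * xi_term_kernel n s t) + xi_tail_kernel k ls N s t)"
    unfolding xi_integral_eq[OF ks(1) ne] ks(2) xi_integrand_split[OF idx, of _ s N] ..
  also have "(LINT t|lborel. (\<Sum>n<N. of_real (polylog_coeff k ls (Suc n)) * xi_term_kernel n s t) + xi_tail_kernel k ls N s t) =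
      (LINT t|lborel. (\<Sum>n<N. of_real (polylog_coeff k ls (Suc n)) * xi_term_kernel n s t)) +
      (LINT t|lborel. xi_tail_kernel k ls N s t)"
    by (intro Bochner_Integration.integral_add Bochner_Integration.integrable_sum terms(1)
        xi_tail_kernel_integrable[OF idx s]) auto
  also have "(LINT t|lborel. (\<Sum>n<N. of_real (polylog_coeff k ls (Suc n)) * xi_term_kernel n s t)) =
      (\<Sum>n<N. LINT t|lborel. of_real (polylog_coeff k ls (Suc n)) * xi_term_kernel n s t)"
    by (intro Bochner_Integration.integral_sum terms(1)) auto
  also have "rGamma s * ((\<Sum>n<N. LINT t|lborel. of_real (polylog_coeff k ls (Suc n)) * xi_term_kernel n s t) +
      (LINT t|lborel. xi_tail_kernel k ls N s t)) = xi_continuation k ls N s"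
    unfolding xi_continuation_def distrib_left sum_distrib_left
    by (intro arg_cong2[of _ _ _ _ "(+)"] sum.cong refl terms(2)) auto
  finally show ?thesis ..
qed

lemma xi_properties:
  assumes ks: "is_index ks" "ks \<noteq> []"
  shows "xi ks holomorphic_on UNIV" "\<And>s. Re s > 1 - real (length ks) \<Longrightarrow> xi ks s = xi_integral ks s"
proof -
  let ?P = "\<lambda>f. f holomorphic_on UNIV \<and> (\<forall>s. Re s > 1 - real (length ks) \<longrightarrow> f s = xi_integral ks s)"
  obtain k ls where kls: "rev ks = k # ls"
    using ks by (metis list.exhaust rev_is_Nil_conv)
  have idx: "is_index (k # ls)"
    using ks kls by (metis is_index_rev)
  have len: "length ks = Suc (length ls)"
    using arg_cong[OF kls, of length] by simp
  let ?F = "xi_continuation k ls"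
  have nice: "?F n nicely_meromorphic_on {s. Re s > 0 - real n}" for n
    using xi_continuation_holomorphic[OF idx, of n]
    by (intro analytic_on_imp_nicely_meromorphic_on) (simp add: analytic_on_open)
  have eq: "?F n s = xi_integral ks s" if "Re s > 0" for n s
    by (rule xi_continuation_eq_integral[OF ks(1) kls]) (use that in auto)
  have "\<exists>f. f nicely_meromorphic_on UNIV \<and> (\<forall>s. Re s > 0 \<longrightarrow> f s = xi_integral ks s) \<and>
      (\<forall>n s. Re s > 0 - real n \<longrightarrow> f s = ?F n s)"
    by (rule nicely_meromorphic_glue) (fact nice eq)+
  then obtain f where f: "\<And>n s. Re s > - real n \<Longrightarrow> f s = ?F n s"
    by auto
  \<comment> \<open>Gluing gives only a nicely meromorphic function, but near each point it
    coincides with a holomorphic piece.\<close>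
  have "f holomorphic_on UNIV"
  proof (rule holomorphic_onI)
    fix z :: complex
    obtain n where n: "Re z > - real n"
      using reals_Archimedean2[of "- Re z"] by (auto simp: minus_less_iff)
    have "f holomorphic_on {s. Re s > - real n}"
      using xi_continuation_holomorphic[OF idx, of n] by (rule holomorphic_transform) (use f in auto)
    then have "f field_differentiable at z"
      using n by (auto simp: holomorphic_on_open field_differentiable_def)
    then show "f field_differentiable at z within UNIV"
      by simp
  qed
  moreover have "f s = xi_integral ks s" if s: "Re s > 1 - real (length ks)" for s
  proof -
    \<comment> \<open>The outermost of r variables is at least r, so the first r - 1 coefficients
      vanish. Taking N = r - 1 reaches exactly the boundary 1 - r.\<close>
    have "polylog_coeff k ls (Suc n) = 0" if "n < length ls" for n
      using that hsum_eq_0[of "Suc n" ls] by (cases "ls = []") (auto simp: polylog_coeff_def)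
    then have "?F (length ls) s = xi_integral ks s"
      using s len by (intro xi_continuation_eq_integral[OF ks(1) kls]) auto
    then show ?thesis
      using f[of "length ls" s] s len by simp
  qed
  ultimately have P: "?P f"
    by blast
  have "?P (xi ks)"
    unfolding xi_def
  proof (rule theI[of ?P, OF P])
    fix g assume g: "?P g"
    show "g = f"
    proof
      fix z
      show "g z = f z"
      proof (rule nicely_meromorphic_eqI[where S = UNIV and U = "{s. Re s > 1 - real (length ks)}" and f = g and g = f])
        show "{s. Re s > 1 - real (length ks)} \<noteq> {}"
          by (auto intro!: exI[of _ 2])
        show "g nicely_meromorphic_on UNIV" "f nicely_meromorphic_on UNIV"
          using g P by (auto intro!: analytic_on_imp_nicely_meromorphic_on simp: analytic_on_open)
      qed (use P g in auto)
    qed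
  qed
  then show "xi ks holomorphic_on UNIV" "\<And>s. Re s > 1 - real (length ks) \<Longrightarrow> xi ks s = xi_integral ks s"
    by blast+
qed

theorem theorem3p6:
  fixes ks :: "nat list"
  assumes "is_index ks" and "ks \<noteq> []"
  shows "\<exists>c :: nat list \<Rightarrow> nat \<Rightarrow> real.
    (\<forall>(ks', j) \<in> index_pairs (sum_list ks).
       c ks' j \<in> rat_span (mzvs_of_weight (sum_list ks - sum_list ks' - j))) \<and>
    (\<forall>\<^sub>\<approx>s\<in>UNIV. xi ks s =
       (\<Sum>(ks', j) \<in> index_pairs (sum_list ks).
          of_real (c ks' j) * ((s + of_nat j - 1) gchoose j) * mzeta ks' (s + of_nat j)))"
proof -
  let ?w = "sum_list ks"
  have "polylog_combination ?w (\<lambda>z. polylog (rev ks) (1 - z))"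
    using connection_formula[of "rev ks"] assms by simp
  then obtain c where c: "\<forall>(ls, j)\<in>index_pairs ?w. c ls j \<in> mzv_span (?w - sum_list ls - j)"
    "\<And>z. z \<in> {0<..<1} \<Longrightarrow> polylog (rev ks) (1 - z) =
      (\<Sum>(ls, j)\<in>index_pairs ?w. c ls j * logpow j z * polylog (rev ls) z)"
    unfolding polylog_combination_def by blast
  define R where "R s = (\<Sum>(ls, j)\<in>index_pairs ?w.
    of_real (c ls j) * ((s + of_nat j - 1) gchoose j) * mzeta ls (s + of_nat j))" for s
  \<comment> \<open>Identity of meromorphic functions means equality off a sparse set:
    \<open>mzeta\<close> is 0 by convention at its poles, where the sum need not take the value of
    the entire function \<open>xi ks\<close>.\<close>
  have "\<forall>\<^sub>\<approx>s\<in>UNIV. xi ks s = R s"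
  proof (rule meromorphic_eq_cosparse[of _ _ _ "{s. Re s > 1}"])
    show "xi ks meromorphic_on UNIV"
      using xi_properties(1)[OF assms] by (intro analytic_on_imp_meromorphic_on) (simp add: analytic_on_open)
    show "R meromorphic_on UNIV"
      unfolding R_def case_prod_unfold
    proof (intro meromorphic_intros)
      fix p assume "p \<in> index_pairs ?w"
      then have "mzeta (fst p) meromorphic_on UNIV"
        using mzeta_properties(1)[of "fst p"] by (auto simp: index_pairs_def nicely_meromorphic_on_def)
      then show "(\<lambda>s. mzeta (fst p) (s + of_nat (snd p))) meromorphic_on UNIV"
        by (rule meromorphic_on_compose) (auto intro!: analytic_intros)
      have "(\<lambda>s. (s + of_nat (snd p) - 1) gchoose snd p) holomorphic_on UNIV"
        unfolding gbinomial_prod_rev by (intro holomorphic_intros) auto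
      then show "(\<lambda>s. (s + of_nat (snd p) - 1) gchoose snd p) meromorphic_on UNIV"
        by (intro analytic_on_imp_meromorphic_on) (simp add: analytic_on_open)
    qed
    show "xi ks s = R s" if "s \<in> {s. Re s > 1}" for s
    proof -
      have "xi ks s = xi_integral ks s"
        using that by (intro xi_properties(2) assms) auto
      also have "\<dots> = R s"
        unfolding R_def using that by (intro xi_integral_connection assms c(2)) auto
      finally show ?thesis .
    qed
    show "{s. Re s > 1} \<noteq> {}"
      by (auto intro!: exI[of _ 2])
  qed auto
  then show ?thesis
    using c(1) unfolding R_def by blast
qed

end
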